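(* Let $P$ be a product rule whose $P$-product is bilinear, associative and commutative. There is an algorithm which, given a finite alphabet $\Sigma$, two polynomial $P$-automata $\mathcal A=\langle X,F,\Delta\rangle$ and $\mathcal B=\langle Y,G,\Gamma\rangle$ with finite variable sets and rational data, and distinguished variables $x_1\in X$, $y_1\in Y$, decides whether $[\![x_1]\!]_{\mathcal A}=[\![y_1]\!]_{\mathcal B}$.
   Context: Let $\Sigma$ be a finite alphabet, $\Sigma^*$ the finite words with empty word $\varepsilon$. A series is $f:\Sigma^*\to\mathbb Q$, $f_w=f(w)$; series form a $\mathbb Q$-vector space under pointwise operations; $\delta_af$ ($a\in\Sigma$) is $w\mapsto f(aw)$. Terms over $X$: generated by $u,v::=x\mid 0\mid c\cdot u\mid u+v\mid u*v$. A product rule is a term $P$ over $\{x,\dot x,y,\dot y\}$. The $P$-product $*$ and semantics $[\![u]\!]_\varrho$ of terms under valuations are the unique pair with $(f*g)_\varepsilon=f_\varepsilon g_\varepsilon$, $\delta_a(f*g)=[\![P]\!]_{[x\mapsto f,\dot x\mapsto\delta_af,y\mapsto g,\dot y\mapsto\delta_ag]}$, and $[\![\cdot]\!]_\varrho$ interpreting variables via $\varrho$, constructors by zero, scalar multiplication, addition, $*$. The product is BAC if for all series $f,g,h$, $c\in\mathbb Q$: $(f+g)*h=f*h+g*h$, $(cf)*g=c(f*g)$, $f*(g*h)=(f*g)*h$, $f*g=g*f$. $\mathbb Q_0[X]$ is the set of polynomials in $\mathbb Q[X]$ with zero constant term. For such $P$, every $D:X\to\mathbb Q_0[X]$ has a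 unique $\mathbb Q$-linear extension $\tilde D:\mathbb Q_0[X]\to\mathbb Q_0[X]$ with $\tilde Dx=Dx$ and $\tilde D(\alpha\beta)=P(\alpha,\tilde D\alpha,\beta,\tilde D\beta)$ ($P$ evaluated as a polynomial). A polynomial $P$-automaton is $\mathcal A=\langle X,F,\Delta\rangle$ with $F:X\to\mathbb Q$, $\Delta_a:X\to\mathbb Q_0[X]$ ($a\in\Sigma$); $F$ extends to $\mathbb Q_0[X]$ by evaluation and $\Delta_a$ to $\tilde\Delta_a$; $[\![\alpha]\!]_{\mathcal A}$ is the unique series with constant term $F(\alpha)$ and $\delta_a[\![\alpha]\!]_{\mathcal A}=[\![\tilde\Delta_a\alpha]\!]_{\mathcal A}$. *)

theory Defs
  imports Complex_Main "HOL-Library.Poly_Mapping" "HOL-Library.Nat_Bijection"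
begin

text \<open>Letters are natural numbers; a finite alphabet is {..<k}.  A series is a
function from words (nat lists) to the rationals.\<close>

type_synonym ser = "nat list \<Rightarrow> rat"

definition delta :: "nat \<Rightarrow> ser \<Rightarrow> ser" where
  "delta a f = (\<lambda>w. f (a # w))"

datatype 'v trm = TVar 'v | TZero | TScal rat "'v trm" | TPlus "'v trm" "'v trm" | TTimes "'v trm" "'v trm"

text \<open>The four variables of a product rule: x, x-dot, y, y-dot.\<close>
datatype pv = PX | PXd | PY | PYd

primrec tsem :: "(ser \<Rightarrow> ser \<Rightarrow> ser) \<Rightarrow> ('v \<Rightarrow> ser) \<Rightarrow> 'v trm \<Rightarrow> ser" where
  "tsem mul \<rho> (TVar v) = \<rho> v"
| "tsem mul \<rho> TZero = (\<lambda>w. 0)"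
| "tsem mul \<rho> (TScal c u) = (\<lambda>w. c * tsem mul \<rho> u w)"
| "tsem mul \<rho> (TPlus u v) = (\<lambda>w. tsem mul \<rho> u w + tsem mul \<rho> v w)"
| "tsem mul \<rho> (TTimes u v) = mul (tsem mul \<rho> u) (tsem mul \<rho> v)"

definition pval :: "ser \<Rightarrow> ser \<Rightarrow> ser \<Rightarrow> ser \<Rightarrow> pv \<Rightarrow> ser" where
  "pval f fd g gd = (\<lambda>v. case v of PX \<Rightarrow> f | PXd \<Rightarrow> fd | PY \<Rightarrow> g | PYd \<Rightarrow> gd)"

definition is_Pprod :: "pv trm \<Rightarrow> (ser \<Rightarrow> ser \<Rightarrow> ser) \<Rightarrow> bool" where
  "is_Pprod P mul \<longleftrightarrow>
     (\<forall>f g. mul f g [] = f [] * g [] \<and>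
        (\<forall>a. delta a (mul f g) = tsem mul (pval f (delta a f) g (delta a g)) P))"

text \<open>The P-product: the unique operation satisfying the defining equations
(the semantics of terms is then determined by it via tsem).\<close>
definition Pprod :: "pv trm \<Rightarrow> ser \<Rightarrow> ser \<Rightarrow> ser" where
  "Pprod P = (THE mul. is_Pprod P mul)"

definition BAC :: "pv trm \<Rightarrow> bool" where
  "BAC P \<longleftrightarrow> (let m = Pprod P in
     (\<forall>f g h. m (\<lambda>w. f w + g w) h = (\<lambda>w. m f h w + m g h w)) \<and>
     (\<forall>c f g. m (\<lambda>w. c * f w) g = (\<lambda>w. c * m f g w)) \<and>
     (\<forall>f g h. m f (m g h) = m (m f g) h) \<and>
     (\<forall>f g. m f g = m g f))"

type_synonym mono = "nat \<Rightarrow>\<^sub>0 nat"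
type_synonym poly = "mono \<Rightarrow>\<^sub>0 rat"

definition pvar :: "nat \<Rightarrow> poly" where
  "pvar x = Poly_Mapping.single (Poly_Mapping.single x 1) 1"

definition pconst :: "rat \<Rightarrow> poly" where
  "pconst c = Poly_Mapping.single 0 c"

definition Q0 :: "poly set" where
  "Q0 = {p. Poly_Mapping.lookup p 0 = 0}"

definition pvars :: "poly \<Rightarrow> nat set" where
  "pvars p = \<Union> (Poly_Mapping.keys ` Poly_Mapping.keys p)"

definition Q0_over :: "nat set \<Rightarrow> poly set" where
  "Q0_over X = {p \<in> Q0. pvars p \<subseteq> X}"

definition evalp :: "(nat \<Rightarrow> rat) \<Rightarrow> poly \<Rightarrow> rat" where
  "evalp F p = (\<Sum>m\<in>Poly_Mapping.keys p. Poly_Mapping.lookup p m * (\<Prod>x\<in>Poly_Mapping.keys m. F x ^ Poly_Mapping.lookup m x))"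

primrec peval :: "('v \<Rightarrow> poly) \<Rightarrow> 'v trm \<Rightarrow> poly" where
  "peval \<sigma> (TVar v) = \<sigma> v"
| "peval \<sigma> TZero = 0"
| "peval \<sigma> (TScal c u) = pconst c * peval \<sigma> u"
| "peval \<sigma> (TPlus u v) = peval \<sigma> u + peval \<sigma> v"
| "peval \<sigma> (TTimes u v) = peval \<sigma> u * peval \<sigma> v"

definition ppval :: "poly \<Rightarrow> poly \<Rightarrow> poly \<Rightarrow> poly \<Rightarrow> pv \<Rightarrow> poly" where
  "ppval a ad b bd = (\<lambda>v. case v of PX \<Rightarrow> a | PXd \<Rightarrow> ad | PY \<Rightarrow> b | PYd \<Rightarrow> bd)"

definition ext_ok :: "pv trm \<Rightarrow> (nat \<Rightarrow> poly) \<Rightarrow> (poly \<Rightarrow> poly) \<Rightarrow> bool" where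
  "ext_ok P D E \<longleftrightarrow>
     (\<forall>p\<in>Q0. E p \<in> Q0) \<and>
     (\<forall>p\<in>Q0. \<forall>q\<in>Q0. E (p + q) = E p + E q) \<and>
     (\<forall>c. \<forall>p\<in>Q0. E (pconst c * p) = pconst c * E p) \<and>
     (\<forall>x. E (pvar x) = D x) \<and>
     (\<forall>p\<in>Q0. \<forall>q\<in>Q0. E (p * q) = peval (ppval p (E p) q (E q)) P)"

text \<open>The unique extension (normalised to 0 outside Q_0, where it is irrelevant).\<close>
definition ext :: "pv trm \<Rightarrow> (nat \<Rightarrow> poly) \<Rightarrow> poly \<Rightarrow> poly" where
  "ext P D = (THE E. ext_ok P D E \<and> (\<forall>p. p \<notin> Q0 \<longrightarrow> E p = 0))"

text \<open>Semantics (Delta_a only matters on X; it is extended by 0 outside X,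
which does not affect Delta_a-tilde on Q_0[X]): asem P X F Delta w alpha is the value at word w of the series
[[alpha]]: constant term F(alpha), and delta_a [[alpha]] = [[ext Delta_a alpha]].\<close>
primrec asem :: "pv trm \<Rightarrow> nat set \<Rightarrow> (nat \<Rightarrow> rat) \<Rightarrow> (nat \<Rightarrow> nat \<Rightarrow> poly) \<Rightarrow> nat list \<Rightarrow> poly \<Rightarrow> rat" where
  "asem P X F \<Delta> [] \<alpha> = evalp F \<alpha>"
| "asem P X F \<Delta> (a # w) \<alpha> = asem P X F \<Delta> w (ext P (\<lambda>x. if x \<in> X then \<Delta> a x else 0) \<alpha>)"

definition valid_aut :: "nat \<Rightarrow> nat set \<Rightarrow> (nat \<Rightarrow> nat \<Rightarrow> poly) \<Rightarrow> bool" where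
  "valid_aut k X \<Delta> \<longleftrightarrow> finite X \<and> (\<forall>a<k. \<forall>x\<in>X. \<Delta> a x \<in> Q0_over X)"

datatype recf = RZ | RS | RId nat | RCn recf "recf list" | RPr recf recf | RMn recf

inductive reval :: "recf \<Rightarrow> nat list \<Rightarrow> nat \<Rightarrow> bool" where
  "reval RZ xs 0"
| "reval RS (x # xs) (Suc x)"
| "i < length xs \<Longrightarrow> reval (RId i) xs (xs ! i)"
| "list_all2 (\<lambda>g y. reval g xs y) gs ys \<Longrightarrow> reval f ys z \<Longrightarrow> reval (RCn f gs) xs z"
| "reval g xs y \<Longrightarrow> reval (RPr g h) (0 # xs) y"
| "reval (RPr g h) (n # xs) y \<Longrightarrow> reval h (n # y # xs) z \<Longrightarrow> reval (RPr g h) (Suc n # xs) z"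
| "reval f (n # xs) 0 \<Longrightarrow> (\<forall>m<n. \<exists>y. reval f (m # xs) y \<and> 0 < y) \<Longrightarrow> reval (RMn f) xs n"

definition rat_code :: "rat \<Rightarrow> nat" where
  "rat_code r = prod_encode (int_encode (fst (quotient_of r)), int_encode (snd (quotient_of r)))"

definition mono_code :: "mono \<Rightarrow> nat" where
  "mono_code m = set_encode ((\<lambda>x. prod_encode (x, Poly_Mapping.lookup m x)) ` Poly_Mapping.keys m)"

definition poly_code :: "poly \<Rightarrow> nat" where
  "poly_code p = set_encode ((\<lambda>m. prod_encode (mono_code m, rat_code (Poly_Mapping.lookup p m))) ` Poly_Mapping.keys p)"

definition aut_code :: "nat \<Rightarrow> nat set \<Rightarrow> (nat \<Rightarrow> rat) \<Rightarrow> (nat \<Rightarrow> nat \<Rightarrow> poly) \<Rightarrow> nat" where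
  "aut_code k X F \<Delta> = list_encode
     [set_encode X,
      set_encode ((\<lambda>x. prod_encode (x, rat_code (F x))) ` X),
      set_encode ((\<lambda>(a, x). prod_encode (a, prod_encode (x, poly_code (\<Delta> a x)))) ` ({..<k} \<times> X))]"

definition input_code :: "nat \<Rightarrow> nat set \<Rightarrow> (nat \<Rightarrow> rat) \<Rightarrow> (nat \<Rightarrow> nat \<Rightarrow> poly) \<Rightarrow> nat
    \<Rightarrow> nat set \<Rightarrow> (nat \<Rightarrow> rat) \<Rightarrow> (nat \<Rightarrow> nat \<Rightarrow> poly) \<Rightarrow> nat \<Rightarrow> nat" where
  "input_code k X F \<Delta> x1 Y G \<Gamma> y1 =
     list_encode [k, aut_code k X F \<Delta>, x1, aut_code k Y G \<Gamma>, y1]"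

end

theory Submission
  imports Defs "HOL-Computational_Algebra.Polynomial" "HOL-Library.Multiset"
begin

text \<open>
  Evaluating a bilinear, associative and commutative product at one-letter words shows that its rule
  is \<open>a x y + b (x y' + x' y) + c x' y'\<close> with \<open>b\<^sup>2 = b + a c\<close>. Consequently the extended
  transitions are well defined, and the ideal generated by a set of polynomials without constant term
  is mapped into itself as soon as the generators are. The equivalence question asks whether all
  derivatives of \<open>x\<^sub>1 - y\<^sub>1\<close> in the disjoint union of the automata evaluate to zero. A negative
  answer is witnessed by a word. By Hilbert's basis theorem finitely many derivatives generate
  the ideal of all of them, so a positive answer is witnessed by finitely many words together with
  cofactors expressing the next derivatives as combinations of these. Both kinds of witnesses can
  be checked by a recursive function, and an unbounded search finds one of them.
\<close>

section \<open>Product rules of bilinear, associative and commutative products\<close>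

text \<open>The axioms speak about series, while the rule is a term of arbitrary degree whose syntax
  shows no bilinearity. One-letter words bridge the gap because constant terms multiply: the value
  of a product at \<open>[0]\<close> is \<open>P\<close> evaluated at four rationals, which can be
  prescribed freely. The relation \<open>b * b = b + a * c\<close> is associativity at the pairs (1,
  0), (1, 0), (0, 1), and the associativity defect of the normal form is a multiple of
  \<open>b + a * c - b * b\<close>; its vanishing is what lets a map on variables extend to
  products.

  The extension is not a derivation of the polynomial ring: its product rule holds only for factors
  without constant term, whereas cofactors in an ideal are arbitrary. Splitting the constant off a
  cofactor repairs this, since every term of the rule contains \<open>y\<close> or
  \<open>y'\<close>.

  The basis theorem gives no bound on the words. Guessing the cofactors along with the words reduces
  checking to polynomial identities and avoids any ideal membership test.\<close>

definition agree_upto :: "nat \<Rightarrow> ser \<Rightarrow> ser \<Rightarrow> bool" where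
  "agree_upto n f g \<longleftrightarrow> (\<forall>w. length w \<le> n \<longrightarrow> f w = g w)"

text \<open>Scaling and addition act word by word, so the product is the only constructor that could
  lose precision.\<close>

lemma tsem_agree_upto:
  assumes "\<And>f f' g g'. agree_upto n f f' \<Longrightarrow> agree_upto n g g' \<Longrightarrow> agree_upto n (m f g) (m' f' g')"
    and "\<And>v. agree_upto n (\<rho> v) (\<rho>' v)"
  shows "agree_upto n (tsem m \<rho> t) (tsem m' \<rho>' t)"
proof (induction t)
  case (TTimes t1 t2)
  then show ?case using assms(1) by simp
qed (use assms(2) in \<open>auto simp: agree_upto_def\<close>)

lemma agree_upto_pval:
  assumes "agree_upto (Suc n) f f'" "agree_upto (Suc n) g g'"
  shows "agree_upto n (pval f (delta a f) g (delta a g) v) (pval f' (delta a f') g' (delta a g') v)"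
  using assms by (cases v) (auto simp: agree_upto_def pval_def delta_def)

text \<open>Stage \<open>n\<close> of the recursion defining the product is correct on words of length at most \<open>n\<close>.\<close>

primrec approx_prod :: "pv trm \<Rightarrow> nat \<Rightarrow> ser \<Rightarrow> ser \<Rightarrow> ser" where
  "approx_prod P 0 = (\<lambda>f g w. f [] * g [])"
| "approx_prod P (Suc n) = (\<lambda>f g w. case w of [] \<Rightarrow> f [] * g []
     | a # w' \<Rightarrow> tsem (approx_prod P n) (pval f (delta a f) g (delta a g)) P w')"

lemma approx_prod_Nil [simp]: "approx_prod P n f g [] = f [] * g []"
  by (cases n) auto

text \<open>Nested products in \<open>P\<close> have factors that were themselves computed at
  different stages; the induction must therefore allow arguments that agree only up to
  \<open>n\<close>.\<close>

lemma approx_prod_agree: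
  "n \<le> k \<Longrightarrow> n \<le> k' \<Longrightarrow> agree_upto n f f' \<Longrightarrow> agree_upto n g g' \<Longrightarrow>
   agree_upto n (approx_prod P k f g) (approx_prod P k' f' g')"
proof (induction n arbitrary: k k' f f' g g')
  case 0
  then show ?case by (auto simp: agree_upto_def)
next
  case (Suc n)
  obtain j j' where k: "k = Suc j" "k' = Suc j'" "n \<le> j" "n \<le> j'"
    using Suc.prems(1,2) by (auto simp: Suc_le_eq dest!: less_imp_Suc_add)
  have nil: "f [] = f' []" "g [] = g' []" using Suc.prems by (auto simp: agree_upto_def)
  have step: "agree_upto n (tsem (approx_prod P j) (pval f (delta a f) g (delta a g)) P)
      (tsem (approx_prod P j') (pval f' (delta a f') g' (delta a g')) P)" for a
    using k Suc by (intro tsem_agree_upto agree_upto_pval) auto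
  show ?case unfolding agree_upto_def
  proof (intro allI impI)
    fix w :: "nat list" assume "length w \<le> Suc n"
    then show "approx_prod P k f g w = approx_prod P k' f' g' w"
      using nil step by (cases w) (auto simp: agree_upto_def k)
  qed
qed

lemma is_Pprod_agree:
  assumes "is_Pprod P m" "is_Pprod P m'"
  shows "agree_upto n f f' \<Longrightarrow> agree_upto n g g' \<Longrightarrow> agree_upto n (m f g) (m' f' g')"
proof (induction n arbitrary: f f' g g')
  case 0
  then show ?case using assms by (auto simp: agree_upto_def is_Pprod_def)
next
  case (Suc n)
  have step: "agree_upto n (delta a (m f g)) (delta a (m' f' g'))" for a
    using assms Suc by (auto simp: is_Pprod_def intro!: tsem_agree_upto agree_upto_pval)
  have nil: "m f g [] = m' f' g' []"
    using assms Suc.prems by (auto simp: agree_upto_def is_Pprod_def)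
  show ?case unfolding agree_upto_def
  proof (intro allI impI)
    fix w :: "nat list" assume "length w \<le> Suc n"
    then show "m f g w = m' f' g' w"
      using nil step by (cases w) (auto simp: agree_upto_def delta_def)
  qed
qed

text \<open>Justifies the \<open>THE\<close> in \<open>Pprod\<close>. Reading each word at the stage
  given by its length yields a solution, because later stages no longer change that value;
  uniqueness is \<open>is_Pprod_agree\<close> with equal arguments.\<close>

lemma is_Pprod_Pprod: "is_Pprod P (Pprod P)"
proof -
  define m where "m f g w = approx_prod P (length w) f g w" for f g w
  have m_agree: "agree_upto n (approx_prod P n f g) (m f' g')"
    if "agree_upto n f f'" "agree_upto n g g'" for n f f' g g'
    unfolding agree_upto_def m_def
  proof (intro allI impI)
    fix w :: "nat list" assume "length w \<le> n"
    with that have "agree_upto (length w) (approx_prod P n f g) (approx_prod P (length w) f' g')"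
      by (intro approx_prod_agree) (auto simp: agree_upto_def)
    then show "approx_prod P n f g w = approx_prod P (length w) f' g' w"
      by (auto simp: agree_upto_def)
  qed
  have step: "delta a (m f g) w = tsem m (pval f (delta a f) g (delta a g)) P w" for a f g w
  proof -
    have "agree_upto (length w) (tsem (approx_prod P (length w)) (pval f (delta a f) g (delta a g)) P)
      (tsem m (pval f (delta a f) g (delta a g)) P)"
      by (intro tsem_agree_upto m_agree) (auto simp: agree_upto_def)
    then show ?thesis by (simp add: agree_upto_def m_def delta_def)
  qed
  have ex: "is_Pprod P m" unfolding is_Pprod_def using step by (auto simp: m_def fun_eq_iff)
  have uniq: "m' = m" if "is_Pprod P m'" for m'
  proof (intro ext)
    fix f g :: ser and w :: "nat list"
    have "agree_upto (length w) (m' f g) (m f g)"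
      by (rule is_Pprod_agree[OF that ex]) (auto simp: agree_upto_def)
    then show "m' f g w = m f g w" by (auto simp: agree_upto_def)
  qed
  show ?thesis unfolding Pprod_def by (rule theI[where P = "is_Pprod P"]) (use ex uniq in auto)
qed

section \<open>Terms and polynomials as functions on the rationals\<close>

primrec rat_eval :: "('v \<Rightarrow> rat) \<Rightarrow> 'v trm \<Rightarrow> rat" where
  "rat_eval s (TVar v) = s v"
| "rat_eval s TZero = 0"
| "rat_eval s (TScal c u) = c * rat_eval s u"
| "rat_eval s (TPlus u v) = rat_eval s u + rat_eval s v"
| "rat_eval s (TTimes u v) = rat_eval s u * rat_eval s v"

lemma tsem_Nil:
  assumes "\<And>f g. m f g [] = f [] * g []"
  shows "tsem m \<rho> t [] = rat_eval (\<lambda>v. \<rho> v []) t"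
  using assms by (induction t) auto

definition mono_eval :: "(nat \<Rightarrow> rat) \<Rightarrow> mono \<Rightarrow> rat" where
  "mono_eval F m = (\<Prod>x\<in>Poly_Mapping.keys m. F x ^ Poly_Mapping.lookup m x)"

lemma mono_eval_superset:
  assumes "finite A" "Poly_Mapping.keys m \<subseteq> A"
  shows "mono_eval F m = (\<Prod>x\<in>A. F x ^ Poly_Mapping.lookup m x)"
  unfolding mono_eval_def using assms
  by (intro prod.mono_neutral_left) (auto simp: in_keys_iff)

lemma mono_eval_add: "mono_eval F (m + m') = mono_eval F m * mono_eval F m'"
proof -
  let ?A = "Poly_Mapping.keys m \<union> Poly_Mapping.keys m'"
  have "Poly_Mapping.keys (m + m') \<subseteq> ?A" by (rule Poly_Mapping.keys_add)
  then show ?thesis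
    by (simp add: mono_eval_superset[of ?A] lookup_add power_add prod.distrib)
qed

lemma poly_mapping_sum_single:
  "p = (\<Sum>m\<in>Poly_Mapping.keys p. Poly_Mapping.single m (Poly_Mapping.lookup p m))"
  by (rule poly_mapping_eqI)
    (auto simp: lookup_sum lookup_single when_def sum.delta not_in_keys_iff_lookup_eq_zero)

text \<open>The single case is demanded only for monomials occurring in \<open>p\<close>. For
  \<open>p\<close> in \<open>Q0\<close> this excludes the monomial 1, on which the product rule says
  nothing.\<close>

lemma poly_mapping_induct_single [case_names zero single add]:
  fixes p :: "'a \<Rightarrow>\<^sub>0 'b::comm_monoid_add"
  assumes "Q 0" and "\<And>m c. m \<in> Poly_Mapping.keys p \<Longrightarrow> Q (Poly_Mapping.single m c)"
    and "\<And>p q. Q p \<Longrightarrow> Q q \<Longrightarrow> Q (p + q)"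
  shows "Q p"
proof -
  have "Q (\<Sum>m\<in>A. Poly_Mapping.single m (Poly_Mapping.lookup p m))"
    if "finite A" "A \<subseteq> Poly_Mapping.keys p" for A
    using that by (induction A rule: finite_induct) (auto intro!: assms)
  then show ?thesis by (subst poly_mapping_sum_single) auto
qed

lemma evalp_alt: "evalp F p = (\<Sum>m\<in>Poly_Mapping.keys p. Poly_Mapping.lookup p m * mono_eval F m)"
  by (simp add: evalp_def mono_eval_def)

lemma evalp_zero [simp]: "evalp F 0 = 0"
  by (simp add: evalp_def)

lemma evalp_single [simp]: "evalp F (Poly_Mapping.single m c) = c * mono_eval F m"
  by (simp add: evalp_alt)

lemma evalp_add [simp]: "evalp F (p + q) = evalp F p + evalp F q"
  unfolding evalp_alt by (rule setsum_keys_plus_distrib) (auto simp: algebra_simps)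

lemma evalp_mult [simp]: "evalp F (p * q) = evalp F p * evalp F q"
proof (induction p rule: poly_mapping_induct_single)
  case (single m c)
  show ?case
    by (induction q rule: poly_mapping_induct_single)
      (auto simp: mult_single mono_eval_add algebra_simps)
qed (auto simp: algebra_simps)

lemma evalp_pconst [simp]: "evalp F (pconst c) = c"
  by (simp add: pconst_def mono_eval_def)

lemma pconst_simps:
  "pconst 0 = 0" "pconst 1 = 1" "pconst (u + v) = pconst u + pconst v"
  "pconst (u * v) = pconst u * pconst v" "pconst (- u) = - pconst u"
  by (auto simp: pconst_def single_add mult_single single_uminus)

lemma evalp_peval: "evalp F (peval \<sigma> t) = rat_eval (\<lambda>v. evalp F (\<sigma> v)) t"
  by (induction t) auto

text \<open>With the other variables fixed, the sum is a univariate polynomial in the value of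
  \<open>x\<close> that vanishes at every rational, so its coefficients vanish. The coefficient at
  exponent \<open>e m0 x\<close> is a sum of the same kind over a fibre of \<open>M\<close>; an
  abstract index set with exponent function \<open>e\<close> lets the induction pass to that
  fibre.\<close>

lemma monomials_independent:
  fixes e :: "'a \<Rightarrow> nat \<Rightarrow> nat" and c :: "'a \<Rightarrow> rat"
  assumes "finite V" "finite M"
    and "\<And>m m'. m \<in> M \<Longrightarrow> m' \<in> M \<Longrightarrow> (\<And>x. x \<in> V \<Longrightarrow> e m x = e m' x) \<Longrightarrow> m = m'"
    and "\<And>F. (\<Sum>m\<in>M. c m * (\<Prod>x\<in>V. F x ^ e m x)) = 0"
    and "m0 \<in> M"
  shows "c m0 = 0"
  using assms
proof (induction V arbitrary: M rule: finite_induct)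
  case empty
  then have "M = {m0}" by auto
  then show ?case using empty(3)[of "\<lambda>_. 0"] by simp
next
  case (insert x V)
  let ?N = "{m \<in> M. e m x = e m0 x}"
  show ?case
  proof (rule insert.IH[of ?N])
    fix F
    define r where "r = (\<Sum>m\<in>M. monom (c m * (\<Prod>y\<in>V. F y ^ e m y)) (e m x))"
    have "poly r t = 0" for t
    proof -
      have V: "(\<Prod>y\<in>V. (F(x := t)) y ^ e m y) = (\<Prod>y\<in>V. F y ^ e m y)" for m
        using insert.hyps(2) by (intro prod.cong) auto
      have "poly r t = (\<Sum>m\<in>M. c m * (\<Prod>y\<in>insert x V. (F(x := t)) y ^ e m y))"
        unfolding r_def poly_sum poly_monom
        using insert.hyps V by (intro sum.cong) (auto simp: mult_ac)
      then show ?thesis using insert.prems(3) by simp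
    qed
    then have "r = 0" by (simp add: poly_all_0_iff_0[symmetric])
    then have "coeff r (e m0 x) = 0" by simp
    then show "(\<Sum>m\<in>?N. c m * (\<Prod>y\<in>V. F y ^ e m y)) = 0"
      using insert.prems(1) unfolding r_def coeff_sum coeff_monom
      by (simp add: sum.inter_filter)
  next
    fix m m' assume "m \<in> ?N" "m' \<in> ?N" "\<And>y. y \<in> V \<Longrightarrow> e m y = e m' y"
    then show "m = m'" by (intro insert.prems(2)) auto
  qed (use insert.prems in auto)
qed

lemma evalp_eq_imp_eq:
  assumes "\<And>F. evalp F p = evalp F q"
  shows "p = q"
proof -
  define r where "r = p - q"
  have "p = r + q" by (simp add: r_def)
  then have r0: "evalp F r = 0" for F using assms[of F] by simp
  let ?V = "\<Union> (Poly_Mapping.keys ` Poly_Mapping.keys r)"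
  have "Poly_Mapping.lookup r m = 0" if m: "m \<in> Poly_Mapping.keys r" for m
  proof (rule monomials_independent[where V = ?V and M = "Poly_Mapping.keys r" and e = Poly_Mapping.lookup])
    fix F
    have "mono_eval F m = (\<Prod>x\<in>?V. F x ^ Poly_Mapping.lookup m x)" if "m \<in> Poly_Mapping.keys r" for m
      using that by (intro mono_eval_superset) auto
    then show "(\<Sum>m\<in>Poly_Mapping.keys r. Poly_Mapping.lookup r m * (\<Prod>x\<in>?V. F x ^ Poly_Mapping.lookup m x)) = 0"
      using r0[of F] by (simp add: evalp_alt)
  next
    fix m m' assume *: "m \<in> Poly_Mapping.keys r" "m' \<in> Poly_Mapping.keys r"
      "\<And>x. x \<in> ?V \<Longrightarrow> Poly_Mapping.lookup m x = Poly_Mapping.lookup m' x"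
    show "m = m'"
    proof (rule poly_mapping_eqI)
      fix x show "Poly_Mapping.lookup m x = Poly_Mapping.lookup m' x"
        using * by (cases "x \<in> ?V") (auto simp: not_in_keys_iff_lookup_eq_zero)
    qed
  qed (use m in auto)
  then have "Poly_Mapping.keys r = {}" by (metis all_not_in_conv in_keys_iff)
  then have "r = 0" by (metis poly_mapping_sum_single sum.empty)
  then show ?thesis using \<open>p = r + q\<close> by simp
qed

text \<open>The value of the product at a one-letter word is \<open>P\<close> evaluated at rationals, so the
  axioms become identities between polynomial functions, hence between polynomials.\<close>

lemma BAC_normal_form:
  assumes "BAC P"
  obtains a b c :: rat where "b * b = b + a * c"
    and "\<And>\<sigma>. peval \<sigma> P = pconst a * (\<sigma> PX * \<sigma> PY) + pconst b * (\<sigma> PX * \<sigma> PYd + \<sigma> PXd * \<sigma> PY)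
            + pconst c * (\<sigma> PXd * \<sigma> PYd)"
proof -
  let ?m = "Pprod P"
  have nil: "?m f g [] = f [] * g []" for f g
    using is_Pprod_Pprod by (auto simp: is_Pprod_def)
  define N where "N x x' y y' = rat_eval (\<lambda>v. case v of PX \<Rightarrow> x | PXd \<Rightarrow> x' | PY \<Rightarrow> y | PYd \<Rightarrow> y') P"
    for x x' y y'
  have one: "?m f g [0] = N (f []) (f [0]) (g []) (g [0])" for f g
  proof -
    have "?m f g [0] = delta 0 (?m f g) []" by (simp add: delta_def)
    also have "\<dots> = tsem ?m (pval f (delta 0 f) g (delta 0 g)) P []"
      using is_Pprod_Pprod[of P] by (auto simp: is_Pprod_def)
    also have "\<dots> = rat_eval (\<lambda>v. pval f (delta 0 f) g (delta 0 g) v []) P"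
      by (rule tsem_Nil) (rule nil)
    also have "(\<lambda>v. pval f (delta 0 f) g (delta 0 g) v []) =
        (\<lambda>v. case v of PX \<Rightarrow> f [] | PXd \<Rightarrow> f [0] | PY \<Rightarrow> g [] | PYd \<Rightarrow> g [0])"
      by (auto simp: fun_eq_iff pval_def delta_def split: pv.split)
    finally show ?thesis by (simp add: N_def)
  qed
  \<comment> \<open>The constant term and the value at \<open>[0]\<close> become an arbitrary pair
    of rationals, so each axiom read at \<open>[0]\<close> is an identity for
    \<open>N\<close>.\<close>
  define s :: "rat \<Rightarrow> rat \<Rightarrow> ser" where "s x y = (\<lambda>w. if w = [] then x else y)" for x y
  have s [simp]: "s x y [] = x" "s x y [0] = y" for x y by (auto simp: s_def)
  from assms have ax:
    "?m (\<lambda>w. f w + g w) h = (\<lambda>w. ?m f h w + ?m g h w)"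
    "?m (\<lambda>w. q * f w) g = (\<lambda>w. q * ?m f g w)"
    "?m f (?m g h) = ?m (?m f g) h" "?m f g = ?m g f" for f g h q
    unfolding BAC_def Let_def by blast+
  have add: "N (x1 + x2) (x1' + x2') y y' = N x1 x1' y y' + N x2 x2' y y'" for x1 x2 x1' x2' y y'
    using fun_cong[OF ax(1)[of "s x1 x1'" "s x2 x2'" "s y y'"], of "[0]"] by (simp add: one)
  have scale: "N (q * x) (q * x') y y' = q * N x x' y y'" for q x x' y y'
    using fun_cong[OF ax(2)[of q "s x x'" "s y y'"], of "[0]"] by (simp add: one)
  have comm: "N x x' y y' = N y y' x x'" for x x' y y'
    using fun_cong[OF ax(4)[of "s x x'" "s y y'"], of "[0]"] by (simp add: one)
  have assoc: "N x x' (y * z) (N y y' z z') = N (x * y) (N x x' y y') z z'" for x x' y y' z z'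
    using fun_cong[OF ax(3)[of "s x x'" "s y y'" "s z z'"], of "[0]"] by (simp add: one nil)
  define a b c where "a = N 1 0 1 0" and "b = N 1 0 0 1" and "c = N 0 1 0 1"
  have split: "N x x' y y' = x * N 1 0 y y' + x' * N 0 1 y y'" for x x' y y'
    using add[of "x * 1" "x' * 0" "x * 0" "x' * 1" y y'] scale[of x 1 0 y y'] scale[of x' 0 1 y y']
    by simp
  \<comment> \<open>Commutativity carries linearity over to the second pair and identifies the two
    mixed coefficients.\<close>
  have form: "N x x' y y' = a * (x * y) + b * (x * y' + x' * y) + c * (x' * y')" for x x' y y'
    using split[of x x' y y'] split[of y y' 1 0] split[of y y' 0 1]
      comm[of 1 0 y y'] comm[of 0 1 y y'] comm[of 0 1 1 0]
    by (simp add: a_def b_def c_def algebra_simps)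
  \<comment> \<open>For the pairs (1, 0), (1, 0), (0, 1) one bracketing gives
    \<open>N 1 0 0 b = b * b\<close>, the other \<open>N 1 a 0 1 = b + a * c\<close>.\<close>
  have "b * b = b + a * c"
    using assoc[of 1 0 1 0 0 1] unfolding form by (simp add: algebra_simps)
  moreover have "peval \<sigma> P = pconst a * (\<sigma> PX * \<sigma> PY) + pconst b * (\<sigma> PX * \<sigma> PYd + \<sigma> PXd * \<sigma> PY)
            + pconst c * (\<sigma> PXd * \<sigma> PYd)" for \<sigma>
  proof (rule evalp_eq_imp_eq)
    fix F
    have "(\<lambda>v. evalp F (\<sigma> v)) = (\<lambda>v. case v of PX \<Rightarrow> evalp F (\<sigma> PX) | PXd \<Rightarrow> evalp F (\<sigma> PXd)
        | PY \<Rightarrow> evalp F (\<sigma> PY) | PYd \<Rightarrow> evalp F (\<sigma> PYd))"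
      by (auto simp: fun_eq_iff split: pv.split)
    then have "evalp F (peval \<sigma> P) = N (evalp F (\<sigma> PX)) (evalp F (\<sigma> PXd)) (evalp F (\<sigma> PY)) (evalp F (\<sigma> PYd))"
      by (simp add: evalp_peval N_def)
    then show "evalp F (peval \<sigma> P) = evalp F (pconst a * (\<sigma> PX * \<sigma> PY)
        + pconst b * (\<sigma> PX * \<sigma> PYd + \<sigma> PXd * \<sigma> PY) + pconst c * (\<sigma> PXd * \<sigma> PYd))"
      by (simp add: form)
  qed
  ultimately show ?thesis using that by blast
qed

section \<open>Computable functions\<close>

text \<open>Lists of other lengths are ignored, so projections can be written with \<open>!\<close>
  and \<open>tl\<close> without case distinctions.\<close>

definition recursive_ary :: "nat \<Rightarrow> (nat list \<Rightarrow> nat) \<Rightarrow> bool" where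
  "recursive_ary n f \<longleftrightarrow> (\<exists>r. \<forall>xs. length xs = n \<longrightarrow> reval r xs (f xs))"

lemma recursive_ary_nth: "i < n \<Longrightarrow> recursive_ary n (\<lambda>xs. xs ! i)"
  unfolding recursive_ary_def by (metis reval.intros(3))

lemma recursive_ary_zero: "recursive_ary n (\<lambda>xs. 0)"
  unfolding recursive_ary_def by (metis reval.intros(1))

lemma recursive_ary_compose1:
  assumes "recursive_ary 1 (\<lambda>xs. f (xs ! 0))" "recursive_ary n g"
  shows "recursive_ary n (\<lambda>xs. f (g xs))"
proof -
  obtain rf rg where r: "\<And>xs. length xs = 1 \<Longrightarrow> reval rf xs (f (xs ! 0))"
    "\<And>xs. length xs = n \<Longrightarrow> reval rg xs (g xs)"
    using assms unfolding recursive_ary_def by metis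
  have "reval (RCn rf [rg]) xs (f (g xs))" if "length xs = n" for xs
    using r(1)[of "[g xs]"] r(2)[OF that] by (intro reval.intros(4)[where ys = "[g xs]"]) auto
  then show ?thesis unfolding recursive_ary_def by blast
qed

lemma recursive_ary_compose2:
  assumes "recursive_ary 2 (\<lambda>xs. f (xs ! 0) (xs ! 1))" "recursive_ary n g" "recursive_ary n h"
  shows "recursive_ary n (\<lambda>xs. f (g xs) (h xs))"
proof -
  obtain rf rg rh where r: "\<And>xs. length xs = 2 \<Longrightarrow> reval rf xs (f (xs ! 0) (xs ! 1))"
    "\<And>xs. length xs = n \<Longrightarrow> reval rg xs (g xs)" "\<And>xs. length xs = n \<Longrightarrow> reval rh xs (h xs)"
    using assms unfolding recursive_ary_def by metis
  have "reval (RCn rf [rg, rh]) xs (f (g xs) (h xs))" if "length xs = n" for xs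
    using r(1)[of "[g xs, h xs]"] r(2,3)[OF that]
    by (intro reval.intros(4)[where ys = "[g xs, h xs]"]) auto
  then show ?thesis unfolding recursive_ary_def by blast
qed

lemma recursive_ary_Suc: "recursive_ary n g \<Longrightarrow> recursive_ary n (\<lambda>xs. Suc (g xs))"
proof (rule recursive_ary_compose1[where f = Suc])
  have "reval RS xs (Suc (xs ! 0))" if "length xs = 1" for xs
    using that reval.intros(2)[of "xs ! 0" "[]"] by (cases xs) auto
  then show "recursive_ary 1 (\<lambda>xs. Suc (xs ! 0))" unfolding recursive_ary_def by blast
qed

lemma reval_RPr:
  assumes "reval rg xs y0" "\<And>i y. reval rh (i # y # xs) (h i y)"
  shows "reval (RPr rg rh) (n # xs) (rec_nat y0 h n)"
  by (induction n) (use assms in \<open>auto intro: reval.intros\<close>)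

lemma recursive_ary_rec:
  assumes "recursive_ary n (\<lambda>xs. g xs)" "recursive_ary (Suc (Suc n)) (\<lambda>xs. h (xs ! 0) (xs ! 1) (tl (tl xs)))"
  shows "recursive_ary (Suc n) (\<lambda>xs. rec_nat (g (tl xs)) (\<lambda>i y. h i y (tl xs)) (xs ! 0))"
proof -
  obtain rg rh where r: "\<And>xs. length xs = n \<Longrightarrow> reval rg xs (g xs)"
    "\<And>xs. length xs = Suc (Suc n) \<Longrightarrow> reval rh xs (h (xs ! 0) (xs ! 1) (tl (tl xs)))"
    using assms unfolding recursive_ary_def by metis
  have "reval (RPr rg rh) xs (rec_nat (g (tl xs)) (\<lambda>i y. h i y (tl xs)) (xs ! 0))"
    if len: "length xs = Suc n" for xs
  proof -
    obtain k ys where xs: "xs = k # ys" "length ys = n" using len by (auto simp: length_Suc_conv)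
    have "reval (RPr rg rh) (k # ys) (rec_nat (g ys) (\<lambda>i y. h i y ys) k)"
    proof (rule reval_RPr)
      fix i y show "reval rh (i # y # ys) (h i y ys)" using r(2)[of "i # y # ys"] xs by simp
    qed (use r xs in auto)
    then show ?thesis by (simp add: xs)
  qed
  then show ?thesis unfolding recursive_ary_def by blast
qed

lemma recursive_ary_cong:
  assumes "recursive_ary n g" "\<And>xs. length xs = n \<Longrightarrow> f xs = g xs"
  shows "recursive_ary n f"
  using assms unfolding recursive_ary_def by metis

section \<open>Arithmetic and pairing by primitive recursion and minimisation\<close>

lemma recursive_ary_plus:
  assumes "recursive_ary n g" "recursive_ary n h"
  shows "recursive_ary n (\<lambda>xs. g xs + h xs)"
proof (rule recursive_ary_compose2[OF _ assms])
  have "recursive_ary (Suc 1) (\<lambda>xs. rec_nat (tl xs ! 0) (\<lambda>i y. Suc y) (xs ! 0))"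
    by (rule recursive_ary_rec) (auto intro!: recursive_ary_Suc recursive_ary_nth)
  then show "recursive_ary 2 (\<lambda>xs. xs ! 0 + xs ! 1)" unfolding Suc_1
  proof (rule recursive_ary_cong)
    fix xs :: "nat list" assume "length xs = 2"
    moreover have "rec_nat a (\<lambda>i y. Suc y) b = b + a" for a b :: nat by (induction b) auto
    ultimately show "xs ! 0 + xs ! 1 = rec_nat (tl xs ! 0) (\<lambda>i y. Suc y) (xs ! 0)"
      by (auto simp: length_Suc_conv numeral_2_eq_2)
  qed
qed

lemma recursive_ary_minus:
  assumes "recursive_ary n g" "recursive_ary n h"
  shows "recursive_ary n (\<lambda>xs. g xs - h xs)"
\<comment> \<open>Recursion runs on the first argument, which has to be the subtrahend; hence the
  swapped order.\<close>
proof (rule recursive_ary_compose2[where f = "\<lambda>x y. y - x", OF _ assms(2,1)])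
  \<comment> \<open>The predecessor is the recursion that returns its counter and forgets the
    previous value.\<close>
  have "recursive_ary (Suc 0) (\<lambda>xs. rec_nat 0 (\<lambda>i y. i) (xs ! 0))"
    by (rule recursive_ary_rec) (auto intro!: recursive_ary_zero recursive_ary_nth)
  moreover have "rec_nat 0 (\<lambda>i y. i) b = b - 1" for b :: nat by (cases b) auto
  ultimately have pred: "recursive_ary 1 (\<lambda>xs. xs ! 0 - 1)" by simp
  have "recursive_ary (Suc 1) (\<lambda>xs. rec_nat (tl xs ! 0) (\<lambda>i y. y - 1) (xs ! 0))"
    by (rule recursive_ary_rec) (auto intro!: recursive_ary_compose1[OF pred] recursive_ary_nth simp del: One_nat_def)
  then show "recursive_ary 2 (\<lambda>xs. xs ! 1 - xs ! 0)" unfolding Suc_1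
  proof (rule recursive_ary_cong)
    fix xs :: "nat list" assume "length xs = 2"
    moreover have "rec_nat a (\<lambda>i y. y - 1) b = a - b" for a b :: nat by (induction b) auto
    ultimately show "xs ! 1 - xs ! 0 = rec_nat (tl xs ! 0) (\<lambda>i y. y - 1) (xs ! 0)"
      by (auto simp: length_Suc_conv numeral_2_eq_2)
  qed
qed

lemma recursive_ary_triangle:
  assumes "recursive_ary n g"
  shows "recursive_ary n (\<lambda>xs. triangle (g xs))"
proof (rule recursive_ary_compose1[OF _ assms])
  have "recursive_ary (Suc 0) (\<lambda>xs. rec_nat 0 (\<lambda>i y. y + Suc i) (xs ! 0))"
    by (rule recursive_ary_rec) (auto intro!: recursive_ary_zero recursive_ary_nth recursive_ary_plus
        recursive_ary_Suc simp del: add_Suc_right)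
  moreover have "rec_nat 0 (\<lambda>i y. y + Suc i) b = triangle b" for b :: nat by (induction b) auto
  ultimately show "recursive_ary 1 (\<lambda>xs. triangle (xs ! 0))" by simp
qed

lemma recursive_ary_prod_encode:
  assumes "recursive_ary n g" "recursive_ary n h"
  shows "recursive_ary n (\<lambda>xs. prod_encode (g xs, h xs))"
  unfolding prod_encode_def using assms
  by (auto intro!: recursive_ary_plus recursive_ary_triangle)

lemma recursive_ary_Least:
  assumes f: "recursive_ary (Suc n) (\<lambda>xs. f (xs ! 0) (tl xs))"
    and ex: "\<And>xs. length xs = n \<Longrightarrow> \<exists>k. f k xs = 0"
  shows "recursive_ary n (\<lambda>xs. LEAST k. f k xs = 0)"
proof -
  obtain r where r: "\<And>xs. length xs = Suc n \<Longrightarrow> reval r xs (f (xs ! 0) (tl xs))"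
    using f unfolding recursive_ary_def by metis
  have "reval (RMn r) xs (LEAST k. f k xs = 0)" if "length xs = n" for xs
  proof (rule reval.intros(7))
    have r': "reval r (k # xs) (f k xs)" for k using r[of "k # xs"] that by simp
    show "reval r ((LEAST k. f k xs = 0) # xs) 0"
      using r'[of "LEAST k. f k xs = 0"] LeastI_ex[OF ex[OF that]] by simp
    show "\<forall>m<LEAST k. f k xs = 0. \<exists>y. reval r (m # xs) y \<and> 0 < y"
      using r' not_less_Least by blast
  qed
  then show ?thesis unfolding recursive_ary_def by blast
qed

text \<open>As \<open>prod_encode (m, n) = triangle (m + n) + m\<close>, the diagonal
  \<open>m + n\<close> of a code \<open>z\<close> is the least \<open>k\<close> with
  \<open>z < triangle (Suc k)\<close>, written below with truncated subtraction; \<open>m\<close> is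
  the remainder.\<close>

lemma recursive_ary_prod_decode:
  "recursive_ary 1 (\<lambda>xs. fst (prod_decode (xs ! 0)))"
  "recursive_ary 1 (\<lambda>xs. snd (prod_decode (xs ! 0)))"
proof -
  define s where "s z = (LEAST k. Suc z - triangle (Suc k) = 0)" for z
  have mono: "triangle i \<le> triangle j" if "i \<le> j" for i j
    using that by (induction j rule: dec_induct) auto
  have s_eq: "s (prod_encode (m, n)) = m + n" for m n
    unfolding s_def
  proof (rule Least_equality)
    fix y assume "Suc (prod_encode (m, n)) - triangle (Suc y) = 0"
    then have "triangle (m + n) < triangle (Suc y)" by (auto simp: prod_encode_def)
    then show "m + n \<le> y" using mono[of "Suc y" "m + n"] by linarith
  qed (simp add: prod_encode_def)
  have dec: "fst (prod_decode z) = z - triangle (s z)"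
    "snd (prod_decode z) = s z - (z - triangle (s z))" for z
  proof -
    obtain m n where "z = prod_encode (m, n)" by (metis prod_decode_inverse surj_pair)
    then show "fst (prod_decode z) = z - triangle (s z)"
      "snd (prod_decode z) = s z - (z - triangle (s z))"
      by (simp_all add: s_eq) (simp_all add: prod_encode_def)
  qed
  have s: "recursive_ary 1 (\<lambda>xs. s (xs ! 0))"
    unfolding s_def
  proof (rule recursive_ary_Least)
    show "recursive_ary (Suc 1) (\<lambda>xs. Suc (tl xs ! 0) - triangle (Suc (xs ! 0)))"
    proof (rule recursive_ary_cong)
      show "recursive_ary (Suc 1) (\<lambda>xs. Suc (xs ! 1) - triangle (Suc (xs ! 0)))"
        by (intro recursive_ary_minus recursive_ary_Suc recursive_ary_triangle recursive_ary_nth) auto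
    qed (auto simp: length_Suc_conv)
  next
    fix xs :: "nat list"
    have "z \<le> triangle z" for z by (induction z) auto
    from this[of "xs ! 0"] show "\<exists>k. Suc (xs ! 0) - triangle (Suc k) = 0"
      by (intro exI[of _ "xs ! 0"]) (simp add: triangle_Suc)
  qed
  show "recursive_ary 1 (\<lambda>xs. fst (prod_decode (xs ! 0)))"
    "recursive_ary 1 (\<lambda>xs. snd (prod_decode (xs ! 0)))"
    unfolding dec
    by (intro recursive_ary_minus recursive_ary_triangle s recursive_ary_nth; simp)+
qed

text \<open>All encodings are bijections, so that every number is the code of a certificate.\<close>

class encodable =
  fixes enc :: "'a \<Rightarrow> nat"
  assumes bij_enc: "bij enc"

lemma enc_eq_iff [simp]: "enc x = enc y \<longleftrightarrow> x = (y :: 'a::encodable)"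
  using bij_enc by (metis bij_is_inj injD)

lemma inv_enc_enc [simp]: "inv enc (enc x) = (x :: 'a::encodable)"
  by (rule inv_f_f[OF bij_is_inj[OF bij_enc]])

lemma enc_inv_enc [simp]: "enc (inv enc n :: 'a::encodable) = n"
  by (rule surj_f_inv_f[OF bij_is_surj[OF bij_enc]])

instantiation nat :: encodable
begin
definition enc_nat_def [simp]: "enc (n :: nat) = n"
instance by standard (auto simp: bij_def inj_def surj_def)
end

instantiation prod :: (encodable, encodable) encodable
begin
definition enc_prod_def: "enc p = prod_encode (enc (fst p), enc (snd p))"
instance
proof
  have "enc = prod_encode \<circ> map_prod (enc :: 'a \<Rightarrow> nat) (enc :: 'b \<Rightarrow> nat)"
    by (auto simp: fun_eq_iff enc_prod_def)
  moreover have "bij (map_prod (enc :: 'a \<Rightarrow> nat) (enc :: 'b \<Rightarrow> nat))"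
    unfolding bij_def
    by (intro conjI prod.inj_map map_prod_surj bij_is_inj bij_is_surj bij_enc)
  ultimately show "bij (enc :: 'a \<times> 'b \<Rightarrow> nat)"
    using bij_comp bij_prod_encode by metis
qed
end

instantiation list :: (encodable) encodable
begin
definition enc_list_def: "enc xs = list_encode (map enc xs)"
instance
proof
  have "enc = list_encode \<circ> map (enc :: 'a \<Rightarrow> nat)"
    by (auto simp: fun_eq_iff enc_list_def)
  moreover have "bij (map (enc :: 'a \<Rightarrow> nat))"
    by (rule o_bij[where g = "map (inv enc)"])
      (auto simp: fun_eq_iff o_def)
  ultimately show "bij (enc :: 'a list \<Rightarrow> nat)"
    using bij_comp bij_list_encode by metis
qed
end

lemma enc_Nil: "enc [] = 0"
  by (simp add: enc_list_def)

lemma enc_Cons: "enc (x # xs) = Suc (enc (x, xs))"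
  by (simp add: enc_list_def enc_prod_def)

section \<open>Computability and decidability on encoded types\<close>

definition computable :: "('a::encodable \<Rightarrow> 'b::encodable) \<Rightarrow> bool" where
  "computable f \<longleftrightarrow> (\<exists>r. \<forall>x. reval r [enc x] (enc (f x)))"

definition decidable :: "('a::encodable \<Rightarrow> bool) \<Rightarrow> bool" where
  "decidable Q \<longleftrightarrow> computable (\<lambda>x. of_bool (Q x) :: nat)"

named_theorems computable_intros

text \<open>Since every number is a code, a function on encoded data corresponds to a total function
  on numbers; closure under composition and recursion is inherited from \<open>recursive_ary\<close>
  through this equivalence.\<close>

lemma computable_recursive_ary:
  "computable f \<longleftrightarrow> (\<exists>g. recursive_ary 1 (\<lambda>xs. g (xs ! 0)) \<and> (\<forall>x. g (enc x) = enc (f x)))"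
proof
  assume "computable f"
  then obtain r where r: "\<And>x. reval r [enc x] (enc (f x))" unfolding computable_def by blast
  define g where "g n = enc (f (inv enc n))" for n
  have "reval r xs (g (xs ! 0))" if "length xs = 1" for xs
  proof -
    obtain n where xs: "xs = [n]" using \<open>length xs = 1\<close> by (auto simp: length_Suc_conv)
    show ?thesis using r[of "inv enc n"] by (simp add: xs g_def)
  qed
  moreover have "g (enc x) = enc (f x)" for x
    by (simp add: g_def)
  ultimately show "\<exists>g. recursive_ary 1 (\<lambda>xs. g (xs ! 0)) \<and> (\<forall>x. g (enc x) = enc (f x))"
    unfolding recursive_ary_def by blast
next
  assume "\<exists>g. recursive_ary 1 (\<lambda>xs. g (xs ! 0)) \<and> (\<forall>x. g (enc x) = enc (f x))"
  then show "computable f"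
    unfolding recursive_ary_def computable_def
    by (metis One_nat_def length_Cons list.size(3) nth_Cons_0)
qed

lemma computable_id [computable_intros]: "computable (\<lambda>x. x)"
  unfolding computable_recursive_ary by (intro exI[of _ "\<lambda>n. n"]) (auto intro: recursive_ary_nth)

lemma computable_const [computable_intros]: "computable (\<lambda>x. c)"
proof -
  have "recursive_ary 1 (\<lambda>xs. k)" for k
    by (induction k) (auto intro: recursive_ary_zero recursive_ary_Suc)
  then show ?thesis unfolding computable_recursive_ary by (intro exI[of _ "\<lambda>n. enc c"]) auto
qed

lemma computable_compose:
  assumes "computable f" "computable g"
  shows "computable (\<lambda>x. f (g x))"
proof -
  obtain f' g' where "recursive_ary 1 (\<lambda>xs. f' (xs ! 0))" "\<And>x. f' (enc x) = enc (f x)"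
    "recursive_ary 1 (\<lambda>xs. g' (xs ! 0))" "\<And>x. g' (enc x) = enc (g x)"
    using assms unfolding computable_recursive_ary by metis
  then show ?thesis unfolding computable_recursive_ary
    by (intro exI[of _ "\<lambda>n. f' (g' n)"]) (auto intro: recursive_ary_compose1)
qed

text \<open>The result types may differ: only codes are seen. Decoders such as
  \<open>prod_decode\<close> and \<open>inv enc\<close> are thus the identity on codes, and a truth
  value may be replaced by any number with the same value.\<close>

lemma computable_enc_cong:
  assumes "computable f" "\<And>x. enc (f x) = enc (g x)"
  shows "computable g"
  using assms unfolding computable_def by simp

lemma computable_enc: "computable (enc :: 'a::encodable \<Rightarrow> nat)"
  by (rule computable_enc_cong[OF computable_id]) simp

lemma computable_Pair [computable_intros]:
  assumes "computable f" "computable g"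
  shows "computable (\<lambda>x. (f x, g x))"
proof -
  obtain f' g' where "recursive_ary 1 (\<lambda>xs. f' (xs ! 0))" "\<And>x. f' (enc x) = enc (f x)"
    "recursive_ary 1 (\<lambda>xs. g' (xs ! 0))" "\<And>x. g' (enc x) = enc (g x)"
    using assms unfolding computable_recursive_ary by metis
  then show ?thesis unfolding computable_recursive_ary
    by (intro exI[of _ "\<lambda>n. prod_encode (f' n, g' n)"])
      (auto simp: enc_prod_def intro: recursive_ary_prod_encode)
qed

lemma computable_fst [computable_intros]: "computable f \<Longrightarrow> computable (\<lambda>x. fst (f x))"
  by (rule computable_compose[of fst])
    (auto simp: computable_recursive_ary enc_prod_def
      intro!: exI[of _ "\<lambda>n. fst (prod_decode n)"] recursive_ary_prod_decode[simplified])

lemma computable_snd [computable_intros]: "computable f \<Longrightarrow> computable (\<lambda>x. snd (f x))"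
  by (rule computable_compose[of snd])
    (auto simp: computable_recursive_ary enc_prod_def
      intro!: exI[of _ "\<lambda>n. snd (prod_decode n)"] recursive_ary_prod_decode[simplified])

lemma computable_Suc [computable_intros]: "computable f \<Longrightarrow> computable (\<lambda>x. Suc (f x))"
  by (rule computable_compose[of Suc])
    (auto simp: computable_recursive_ary intro!: exI[of _ Suc] recursive_ary_Suc recursive_ary_nth)

text \<open>All later recursions, on numbers and on lists alike, reduce to this one.\<close>

lemma computable_rec_nat [computable_intros]:
  fixes h :: "'a::encodable \<Rightarrow> nat \<Rightarrow> 'b::encodable \<Rightarrow> 'b"
  assumes g: "computable g" and h: "computable (\<lambda>p. h (fst p) (fst (snd p)) (snd (snd p)))"
    and n: "computable n"
  shows "computable (\<lambda>x. rec_nat (g x) (h x) (n x))"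
proof -
  obtain g' where g': "recursive_ary 1 (\<lambda>xs. g' (xs ! 0))" "\<And>x. g' (enc x) = enc (g x)"
    using g unfolding computable_recursive_ary by metis
  obtain h' where h': "recursive_ary 1 (\<lambda>xs. h' (xs ! 0))"
    "\<And>p. h' (enc p) = enc (h (fst p) (fst (snd p)) (snd (snd p)))"
    using h unfolding computable_recursive_ary by metis
  define k where "k x n = rec_nat (g' x) (\<lambda>i y. h' (prod_encode (x, prod_encode (i, y)))) n" for x n
  have k_eq: "k (enc x) n = enc (rec_nat (g x) (h x) n)" for x n
    by (induction n) (auto simp: k_def g' h'(2)[of "(x, _, _)", simplified enc_prod_def, simplified])
  have "recursive_ary (Suc 1) (\<lambda>xs. rec_nat (g' (tl xs ! 0))
      (\<lambda>i y. h' (prod_encode (tl xs ! 0, prod_encode (i, y)))) (xs ! 0))"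
  proof (rule recursive_ary_rec)
    show "recursive_ary (Suc (Suc 1)) (\<lambda>xs. h' (prod_encode (tl (tl xs) ! 0, prod_encode (xs ! 0, xs ! 1))))"
    proof (rule recursive_ary_cong)
      show "recursive_ary (Suc (Suc 1)) (\<lambda>xs. h' (prod_encode (xs ! 2, prod_encode (xs ! 0, xs ! 1))))"
        by (intro recursive_ary_compose1[OF h'(1)] recursive_ary_prod_encode recursive_ary_nth) auto
    qed (auto simp: length_Suc_conv)
  qed (rule g'(1))
  then have k2: "recursive_ary 2 (\<lambda>xs. k (xs ! 1) (xs ! 0))" unfolding Suc_1
    by (rule recursive_ary_cong) (auto simp: length_Suc_conv numeral_2_eq_2 k_def)
  have "computable (\<lambda>p. rec_nat (g (fst p)) (h (fst p)) (snd p))"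
    unfolding computable_recursive_ary
  proof (intro exI conjI allI)
    show "recursive_ary 1 (\<lambda>xs. k (fst (prod_decode (xs ! 0))) (snd (prod_decode (xs ! 0))))"
      by (rule recursive_ary_compose2[where f = "\<lambda>a b. k b a", OF k2]) (rule recursive_ary_prod_decode)+
  qed (auto simp: enc_prod_def k_eq)
  from computable_compose[OF this computable_Pair[OF computable_id n]] show ?thesis by simp
qed

text \<open>The search may fail to terminate on inputs for which no certificate exists.\<close>

lemma computable_search:
  fixes Q :: "'a::encodable \<Rightarrow> 'c::encodable \<Rightarrow> bool" and g :: "'a \<Rightarrow> 'c \<Rightarrow> 'b::encodable"
  assumes Q: "decidable (\<lambda>p. Q (fst p) (snd p))" and g: "computable (\<lambda>p. g (fst p) (snd p))"
  shows "\<exists>r. \<forall>x. (\<exists>c. Q x c) \<longrightarrow> (\<exists>c. Q x c \<and> reval r [enc x] (enc (g x c)))"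
proof -
  \<comment> \<open>\<open>RMn\<close> looks for a zero, so the truth value is negated first: the
    recursion starts at 1 and drops to 0 after one step.\<close>
  have "computable (\<lambda>p. rec_nat (1 :: nat) (\<lambda>i y. 0) (of_bool (Q (fst p) (snd p))))"
    using Q unfolding decidable_def by (intro computable_intros)
  moreover have "rec_nat (1 :: nat) (\<lambda>i y. 0) (of_bool b) = of_bool (\<not> b)" for b by (cases b) auto
  ultimately have "computable (\<lambda>p. of_bool (\<not> Q (fst p) (snd p)) :: nat)" by simp
  then obtain rq where rq: "\<And>x c. reval rq [enc (x, c)] (of_bool (\<not> Q x c))"
    unfolding computable_def by fastforce
  obtain rg where rg: "\<And>x c. reval rg [enc (x, c)] (enc (g x c))"
    using g unfolding computable_def by fastforce
  \<comment> \<open>\<open>RMn\<close> puts the search variable in front of the input, whereas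
    \<open>Q\<close> expects the input first.\<close>
  have "recursive_ary 2 (\<lambda>xs. prod_encode (xs ! 1, xs ! 0))"
    by (intro recursive_ary_prod_encode recursive_ary_nth) auto
  then obtain rp where "\<And>xs. length xs = 2 \<Longrightarrow> reval rp xs (prod_encode (xs ! 1, xs ! 0))"
    unfolding recursive_ary_def by blast
  from this[of "[_, _]"] have rp: "reval rp [n, m] (prod_encode (m, n))" for n m by simp
  let ?s = "RMn (RCn rq [rp])"
  have "\<exists>c. Q x c \<and> reval (RCn rg [RCn rp [?s, RId 0]]) [enc x] (enc (g x c))" if "\<exists>c. Q x c" for x
  proof -
    let ?d = "inv enc :: nat \<Rightarrow> 'c"
    define n where "n = (LEAST n. Q x (?d n))"
    have "\<exists>n. Q x (?d n)" using that inv_enc_enc by metis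
    then have Qn: "Q x (?d n)" unfolding n_def by (rule LeastI_ex)
    have step: "reval (RCn rq [rp]) [m, enc x] (of_bool (\<not> Q x (?d m)))" for m
      using rq[of x "?d m"] rp[of m "enc x"]
      by (intro reval.intros(4)[where ys = "[prod_encode (enc x, m)]"]) (auto simp: enc_prod_def)
    have s: "reval ?s [enc x] n"
    proof (rule reval.intros(7))
      show "reval (RCn rq [rp]) [n, enc x] 0" using step[of n] Qn by simp
      show "\<forall>m<n. \<exists>y. reval (RCn rq [rp]) [m, enc x] y \<and> 0 < y"
      proof (intro allI impI)
        fix m assume "m < n"
        then have "\<not> Q x (?d m)" unfolding n_def by (rule not_less_Least)
        then show "\<exists>y. reval (RCn rq [rp]) [m, enc x] y \<and> 0 < y" using step[of m] by auto
      qed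
    qed
    have "reval (RCn rp [?s, RId 0]) [enc x] (enc (x, ?d n))"
      using s rp[of n "enc x"] reval.intros(3)[of 0 "[enc x]"]
      by (intro reval.intros(4)[where ys = "[n, enc x]"]) (auto simp: enc_prod_def)
    then have "reval (RCn rg [RCn rp [?s, RId 0]]) [enc x] (enc (g x (?d n)))"
      using rg[of x "?d n"] by (intro reval.intros(4)[where ys = "[enc (x, ?d n)]"]) auto
    then show ?thesis using Qn by blast
  qed
  then show ?thesis by blast
qed

lemma computable_apply2:
  assumes "computable (\<lambda>p. h (fst p) (snd p))" "computable f1" "computable f2"
  shows "computable (\<lambda>x. h (f1 x) (f2 x))"
  using computable_compose[OF assms(1) computable_Pair[OF assms(2,3)]] by simp

lemma computable_apply3:
  assumes "computable (\<lambda>p. h (fst p) (fst (snd p)) (snd (snd p)))"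
    "computable f1" "computable f2" "computable f3"
  shows "computable (\<lambda>x. h (f1 x) (f2 x) (f3 x))"
  using computable_compose[OF assms(1) computable_Pair[OF assms(2) computable_Pair[OF assms(3,4)]]]
  by simp

lemma decidable_apply2:
  assumes "decidable (\<lambda>p. Q (fst p) (snd p))" "computable f1" "computable f2"
  shows "decidable (\<lambda>x. Q (f1 x) (f2 x))"
  using assms computable_apply2[of "\<lambda>x y. of_bool (Q x y) :: nat"] unfolding decidable_def by blast

section \<open>Closure under arithmetic, Boolean operations and decoding\<close>

lemma computable_plus [computable_intros]:
  fixes f g :: "'a::encodable \<Rightarrow> nat"
  assumes "computable f" "computable g"
  shows "computable (\<lambda>x. f x + g x)"
proof -
  have eq: "rec_nat m (\<lambda>i. Suc) n = n + m" for m n by (induction n) auto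
  have "computable (\<lambda>x. rec_nat (g x) (\<lambda>i y. Suc y) (f x))" by (intro computable_intros assms)
  then show ?thesis by (simp add: eq)
qed

lemma computable_times [computable_intros]:
  fixes f g :: "'a::encodable \<Rightarrow> nat"
  assumes "computable f" "computable g"
  shows "computable (\<lambda>x. f x * g x)"
proof -
  have eq: "rec_nat 0 (\<lambda>i y. y + m) n = n * m" for m n :: nat by (induction n) auto
  have "computable (\<lambda>x. rec_nat 0 (\<lambda>i y. y + g x) (f x))"
    by (intro computable_intros assms computable_compose[OF assms(2)])
  then show ?thesis by (simp add: eq)
qed

lemma computable_minus [computable_intros]:
  fixes f g :: "'a::encodable \<Rightarrow> nat"
  assumes "computable f" "computable g"
  shows "computable (\<lambda>x. f x - g x)"
proof -
  have pred: "rec_nat 0 (\<lambda>i y. i) n = n - 1" for n :: nat by (cases n) auto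
  have eq: "rec_nat m (\<lambda>i y. y - 1) n = m - n" for m n :: nat by (induction n) auto
  have "computable (\<lambda>x. rec_nat (f x) (\<lambda>i y. rec_nat 0 (\<lambda>i y. i) y) (g x))"
    by (intro computable_intros assms)
  then show ?thesis by (simp only: eq pred)
qed

lemma computable_of_bool [computable_intros]:
  "decidable Q \<Longrightarrow> computable (\<lambda>x. of_bool (Q x) :: nat)"
  by (simp add: decidable_def)

lemma decidable_not [computable_intros]:
  assumes "decidable Q"
  shows "decidable (\<lambda>x. \<not> Q x)"
proof -
  have "computable (\<lambda>x. 1 - of_bool (Q x) :: nat)" by (intro computable_intros assms)
  then show ?thesis unfolding decidable_def by (rule computable_enc_cong) auto
qed

lemma decidable_conj [computable_intros]:
  assumes "decidable Q" "decidable R"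
  shows "decidable (\<lambda>x. Q x \<and> R x)"
proof -
  have "computable (\<lambda>x. of_bool (Q x) * of_bool (R x) :: nat)" by (intro computable_intros assms)
  then show ?thesis unfolding decidable_def by (rule computable_enc_cong) auto
qed

lemma decidable_disj [computable_intros]:
  assumes "decidable Q" "decidable R"
  shows "decidable (\<lambda>x. Q x \<or> R x)"
proof -
  have "decidable (\<lambda>x. \<not> (\<not> Q x \<and> \<not> R x))" by (intro computable_intros assms)
  then show ?thesis by simp
qed

lemma decidable_le [computable_intros]:
  fixes f g :: "'a::encodable \<Rightarrow> nat"
  assumes "computable f" "computable g"
  shows "decidable (\<lambda>x. f x \<le> g x)"
proof -
  have "computable (\<lambda>x. 1 - (f x - g x))" by (intro computable_intros assms)
  then show ?thesis unfolding decidable_def by (rule computable_enc_cong) auto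
qed

lemma decidable_less [computable_intros]:
  fixes f g :: "'a::encodable \<Rightarrow> nat"
  assumes "computable f" "computable g"
  shows "decidable (\<lambda>x. f x < g x)"
  unfolding Suc_le_eq[symmetric] by (intro computable_intros assms)

lemma decidable_eq [computable_intros]:
  assumes "computable f" "computable g"
  shows "decidable (\<lambda>x. f x = g x)"
proof -
  have "decidable (\<lambda>x. enc (f x) \<le> enc (g x) \<and> enc (g x) \<le> enc (f x))"
    by (intro computable_intros computable_compose[OF computable_enc] assms)
  then show ?thesis unfolding order_eq_iff[symmetric] by simp
qed

lemma computable_if [computable_intros]:
  assumes "decidable Q" "computable f" "computable g"
  shows "computable (\<lambda>x. if Q x then f x else g x)"
proof -
  have "computable (\<lambda>x. rec_nat (g x) (\<lambda>i y. f x) (of_bool (Q x)))"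
    by (intro computable_intros assms computable_compose[OF assms(2)])
  then show ?thesis by (rule computable_enc_cong) auto
qed

lemma decidable_odd [computable_intros]:
  fixes f :: "'a::encodable \<Rightarrow> nat"
  assumes "computable f"
  shows "decidable (\<lambda>x. odd (f x))"
proof -
  have eq: "rec_nat 0 (\<lambda>i y. 1 - y) n = (of_bool (odd n) :: nat)" for n :: nat by (induction n) auto
  have "computable (\<lambda>x. rec_nat 0 (\<lambda>i y. 1 - y) (f x) :: nat)" by (intro computable_intros assms)
  then show ?thesis unfolding decidable_def by (simp only: eq)
qed

lemma computable_div2 [computable_intros]:
  fixes f :: "'a::encodable \<Rightarrow> nat"
  assumes "computable f"
  shows "computable (\<lambda>x. f x div 2)"
proof -
  have eq: "rec_nat 0 (\<lambda>i y. y + of_bool (odd i)) n = n div 2" for n :: nat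
    by (induction n) auto
  have "computable (\<lambda>x. rec_nat 0 (\<lambda>i y. y + of_bool (odd i)) (f x) :: nat)"
    by (intro computable_intros assms)
  then show ?thesis by (simp only: eq)
qed

text \<open>A bit test: after \<open>f x\<close> halvings of \<open>g x\<close> the parity
  decides.\<close>

lemma decidable_in_set_decode [computable_intros]:
  assumes "computable f" "computable g"
  shows "decidable (\<lambda>x. f x \<in> set_decode (g x))"
proof -
  have eq: "rec_nat m (\<lambda>i y. y div 2) n = m div 2 ^ n" for m n :: nat
    by (induction n) (auto simp: div_mult2_eq[symmetric] mult.commute)
  have "decidable (\<lambda>x. odd (rec_nat (g x) (\<lambda>i y. y div 2) (f x)))"
    by (intro computable_intros assms)
  then show ?thesis by (simp add: eq set_decode_def)
qed

lemma computable_inv_enc [computable_intros]: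
  assumes "computable f"
  shows "computable (\<lambda>x. inv enc (f x))"
  by (rule computable_enc_cong[OF assms]) simp

lemma computable_prod_decode [computable_intros]:
  "computable f \<Longrightarrow> computable (\<lambda>x. prod_decode (f x))"
  by (erule computable_enc_cong) (simp add: enc_prod_def)

lemma computable_list_decode [computable_intros]:
  "computable f \<Longrightarrow> computable (\<lambda>x. list_decode (f x))"
proof (erule computable_enc_cong)
  have "map enc xs = xs" for xs :: "nat list" by (simp add: map_idI)
  then show "enc (f x) = enc (list_decode (f x))" for x by (simp add: enc_list_def)
qed

section \<open>Closure under operations on lists\<close>

lemma computable_Cons [computable_intros]:
  assumes "computable f" "computable g"
  shows "computable (\<lambda>x. f x # g x)"
proof -
  have "computable (\<lambda>x. Suc (enc (f x, g x)))"
    by (intro computable_intros computable_compose[OF computable_enc] assms)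
  then show ?thesis by (rule computable_enc_cong) (simp add: enc_Cons)
qed

text \<open>The code of a nonempty list is the successor of the code of head and tail, so case
  distinction is a recursion that ignores the recursive value.\<close>

lemma computable_case_list [computable_intros]:
  fixes h :: "'a::encodable \<Rightarrow> 'b::encodable \<Rightarrow> 'b list \<Rightarrow> 'c::encodable"
  assumes "computable g" "computable (\<lambda>p. h (fst p) (fst (snd p)) (snd (snd p)))" "computable l"
  shows "computable (\<lambda>x. case_list (g x) (h x) (l x))"
proof -
  let ?dec = "inv enc :: nat \<Rightarrow> 'b \<times> 'b list"
  have eq: "rec_nat (g x) (\<lambda>i y. h x (fst (?dec i)) (snd (?dec i))) (enc (l x)) = case_list (g x) (h x) (l x)"
    for x by (cases "l x") (auto simp: enc_Nil enc_Cons)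
  have "computable (\<lambda>x. rec_nat (g x) (\<lambda>i y. h x (fst (?dec i)) (snd (?dec i))) (enc (l x)))"
    by (intro computable_intros assms computable_apply3[OF assms(2)] computable_compose[OF computable_enc])
  then show ?thesis by (simp only: eq)
qed

lemma length_le_enc: "length xs \<le> enc xs"
proof (induction xs)
  case (Cons x xs)
  then show ?case using le_prod_encode_2[of "enc xs" "enc x"] by (simp add: enc_Cons enc_prod_def)
qed simp

text \<open>The state consists of the unread list and the accumulator. It is advanced
  \<open>enc (l x)\<close> times, which is at least the length of the list; surplus steps leave a
  finished state unchanged.\<close>

lemma computable_fold [computable_intros]:
  fixes h :: "'a::encodable \<Rightarrow> 'b::encodable \<Rightarrow> 'c::encodable \<Rightarrow> 'c"
  assumes "computable (\<lambda>p. h (fst p) (fst (snd p)) (snd (snd p)))" "computable l" "computable g"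
  shows "computable (\<lambda>x. fold (h x) (l x) (g x))"
proof -
  define step where "step x s = case_list s (\<lambda>a r. (r, h x a (snd s))) (fst s)" for x and s :: "'b list \<times> 'c"
  have pow: "rec_nat s (\<lambda>i. step x) n = (step x ^^ n) s" for x s n by (induction n) auto
  have run: "(step x ^^ n) (xs, y) = ([], fold (h x) xs y)" if "length xs \<le> n" for x n xs y
    using that
  proof (induction n arbitrary: xs y)
    case (Suc n)
    show ?case
    proof (cases xs)
      case Nil
      have "(step x ^^ m) ([], y) = ([], y)" for m by (induction m) (auto simp: step_def)
      then show ?thesis using Nil by (simp del: funpow.simps)
    next
      case (Cons a r)
      then have "step x (xs, y) = (r, h x a y)" by (simp add: step_def)
      then show ?thesis using Suc.IH[of r "h x a y"] Suc.prems Cons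
        by (simp only: funpow_Suc_right o_apply) simp
    qed
  qed auto
  have "computable (\<lambda>x. snd (rec_nat (l x, g x) (\<lambda>i. step x) (enc (l x))))"
    unfolding step_def
    by (intro computable_intros assms computable_apply3[OF assms(1)] computable_compose[OF computable_enc])
  then show ?thesis by (simp add: pow run length_le_enc)
qed

lemma computable_rev [computable_intros]:
  assumes "computable l"
  shows "computable (\<lambda>x. rev (l x))"
  unfolding rev_conv_fold by (intro computable_intros assms)

text \<open>Structural recursion works from the end of the list, so the fold runs over the reversed
  list and rebuilds the current tail beside the value.\<close>

lemma computable_rec_list [computable_intros]:
  fixes h :: "'a::encodable \<Rightarrow> 'b::encodable \<Rightarrow> 'b list \<Rightarrow> 'c::encodable \<Rightarrow> 'c"
  assumes "computable g"
    "computable (\<lambda>p. h (fst p) (fst (snd p)) (fst (snd (snd p))) (snd (snd (snd p))))" "computable l"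
  shows "computable (\<lambda>x. rec_list (g x) (h x) (l x))"
proof -
  have eq: "fold (\<lambda>a s. (a # fst s, h x a (fst s) (snd s))) (rev xs) ([], g x) = (xs, rec_list (g x) (h x) xs)"
    for x xs by (induction xs) auto
  have "computable (\<lambda>x. snd (fold (\<lambda>a s. (a # fst s, h x a (fst s) (snd s))) (rev (l x)) ([], g x)))"
    by (intro computable_intros assms)
  then show ?thesis by (simp only: eq snd_conv)
qed

lemma computable_append [computable_intros]:
  assumes "computable f" "computable g"
  shows "computable (\<lambda>x. f x @ g x)"
proof -
  have eq: "rec_list ys (\<lambda>a as y. a # y) xs = xs @ ys" for xs ys :: "'b list" by (induction xs) auto
  have "computable (\<lambda>x. rec_list (g x) (\<lambda>a as y. a # y) (f x))" by (intro computable_intros assms)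
  then show ?thesis by (simp only: eq)
qed

lemma computable_map [computable_intros]:
  assumes "computable (\<lambda>p. h (fst p) (snd p))" "computable l"
  shows "computable (\<lambda>x. map (h x) (l x))"
proof -
  have eq: "rec_list [] (\<lambda>a as y. h x a # y) xs = map (h x) xs" for x xs by (induction xs) auto
  have "computable (\<lambda>x. rec_list [] (\<lambda>a as y. h x a # y) (l x))"
    by (intro computable_intros assms computable_apply2[OF assms(1)])
  then show ?thesis by (simp only: eq)
qed

lemma computable_concat [computable_intros]:
  assumes "computable l"
  shows "computable (\<lambda>x. concat (l x))"
proof -
  have eq: "rec_list [] (\<lambda>a as y. a @ y) xs = concat xs" for xs :: "'b list list" by (induction xs) auto
  have "computable (\<lambda>x. rec_list [] (\<lambda>a as y. a @ y) (l x))" by (intro computable_intros assms)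
  then show ?thesis by (simp only: eq)
qed

lemma computable_filter [computable_intros]:
  assumes "decidable (\<lambda>p. Q (fst p) (snd p))" "computable l"
  shows "computable (\<lambda>x. filter (Q x) (l x))"
proof -
  have eq: "rec_list [] (\<lambda>a as y. if Q x a then a # y else y) xs = filter (Q x) xs" for x xs
    by (induction xs) auto
  have "computable (\<lambda>x. rec_list [] (\<lambda>a as y. if Q x a then a # y else y) (l x))"
    by (intro computable_intros assms decidable_apply2[OF assms(1)])
  then show ?thesis by (simp only: eq)
qed

lemma decidable_Ball_set [computable_intros]:
  assumes "decidable (\<lambda>p. Q (fst p) (snd p))" "computable l"
  shows "decidable (\<lambda>x. \<forall>a\<in>set (l x). Q x a)"
proof -
  have "decidable (\<lambda>x. filter (\<lambda>a. \<not> Q x a) (l x) = [])"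
    by (intro computable_intros assms)
  then show ?thesis by (simp add: filter_empty_conv)
qed

lemma decidable_Bex_set [computable_intros]:
  assumes "decidable (\<lambda>p. Q (fst p) (snd p))" "computable l"
  shows "decidable (\<lambda>x. \<exists>a\<in>set (l x). Q x a)"
proof -
  have "decidable (\<lambda>x. filter (\<lambda>a. Q x a) (l x) \<noteq> [])"
    by (intro computable_intros assms)
  then show ?thesis by (simp add: filter_empty_conv)
qed

lemma computable_replicate [computable_intros]:
  assumes "computable n" "computable f"
  shows "computable (\<lambda>x. replicate (n x) (f x))"
proof -
  have eq: "rec_nat [] (\<lambda>i y. a # y) k = replicate k a" for a :: 'b and k by (induction k) auto
  have "computable (\<lambda>x. rec_nat [] (\<lambda>i y. f x # y) (n x))"
    by (intro computable_intros assms computable_compose[OF assms(2)])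
  then show ?thesis by (simp only: eq)
qed

lemma computable_upt0 [computable_intros]:
  assumes "computable n"
  shows "computable (\<lambda>x. [0..<n x])"
proof -
  have eq: "rec_nat [] (\<lambda>i y. y @ [i]) k = [0..<k]" for k by (induction k) auto
  have "computable (\<lambda>x. rec_nat [] (\<lambda>i y. y @ [i]) (n x))"
    by (intro computable_intros assms)
  then show ?thesis by (simp only: eq)
qed

section \<open>The extension of a map on variables\<close>

lemma mono_eval_zero: "mono_eval (\<lambda>_. 0) m = (if m = 0 then 1 else 0)"
proof (cases "m = 0")
  case False
  then obtain x where "x \<in> Poly_Mapping.keys m"
    by (metis poly_mapping_sum_single sum.empty all_not_in_conv)
  then show ?thesis using False by (auto simp: mono_eval_def in_keys_iff intro!: bexI[of _ x])
qed (simp add: mono_eval_def)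

text \<open>The constant term is the value at the origin; multiplicativity of evaluation then yields
  the closure properties of \<open>Q0\<close>.\<close>

lemma Q0_iff_evalp: "p \<in> Q0 \<longleftrightarrow> evalp (\<lambda>_. 0) p = 0"
proof -
  have "evalp (\<lambda>_. 0) p = Poly_Mapping.lookup p 0"
    by (auto simp: evalp_alt mono_eval_zero if_distrib sum.delta not_in_keys_iff_lookup_eq_zero cong: if_cong)
  then show ?thesis by (simp add: Q0_def)
qed

lemma evalp_pvar [simp]: "evalp F (pvar x) = F x"
  by (simp add: pvar_def mono_eval_def)

lemma Q0_closed:
  "0 \<in> Q0" "pvar x \<in> Q0" "p \<in> Q0 \<Longrightarrow> q \<in> Q0 \<Longrightarrow> p + q \<in> Q0"
  "p \<in> Q0 \<Longrightarrow> r * p \<in> Q0" "p \<in> Q0 \<Longrightarrow> p * r \<in> Q0"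
  by (auto simp: Q0_iff_evalp)

text \<open>Variables listed with repetition present a monomial in a form that admits recursion;
  permuted lists present the same monomial.\<close>

definition mono_of :: "nat list \<Rightarrow> mono" where
  "mono_of xs = sum_list (map (\<lambda>x. Poly_Mapping.single x 1) xs)"

definition mono_poly :: "nat list \<Rightarrow> Defs.poly" where
  "mono_poly xs = prod_list (map pvar xs)"

lemma mono_of_simps [simp]:
  "mono_of [] = 0" "mono_of (x # xs) = Poly_Mapping.single x 1 + mono_of xs"
  "mono_of (xs @ ys) = mono_of xs + mono_of ys"
  by (auto simp: mono_of_def)

lemma mono_poly_simps [simp]:
  "mono_poly [] = 1" "mono_poly (x # xs) = pvar x * mono_poly xs"
  "mono_poly (xs @ ys) = mono_poly xs * mono_poly ys"
  by (auto simp: mono_poly_def)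

lemma mono_poly_eq: "mono_poly xs = Poly_Mapping.single (mono_of xs) 1"
  by (induction xs) (auto simp: pvar_def mult_single)

lemma mono_poly_Q0: "xs \<noteq> [] \<Longrightarrow> mono_poly xs \<in> Q0"
  by (cases xs) (auto intro: Q0_closed)

lemma mono_of_replicate: "mono_of (replicate n x) = Poly_Mapping.single x n"
  by (induction n) (auto simp: single_add[symmetric])

lemma mono_of_surj: "\<exists>xs. mono_of xs = m"
proof (induction m rule: poly_mapping_induct_single)
  case zero
  show ?case by (rule exI[of _ "[]"]) simp
next
  case (single x n)
  show ?case using mono_of_replicate by blast
next
  case (add p q)
  then show ?case using mono_of_simps(3) by metis
qed

lemma lookup_mono_of: "Poly_Mapping.lookup (mono_of xs) x = count (mset xs) x"
  by (induction xs) (auto simp: lookup_add lookup_single when_def)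

lemma mono_of_eq_iff: "mono_of xs = mono_of ys \<longleftrightarrow> mset xs = mset ys"
  by (simp add: poly_mapping_eq_iff multiset_eq_iff fun_eq_iff lookup_mono_of)

lemma mono_of_eq_0_iff: "mono_of xs = 0 \<longleftrightarrow> xs = []"
  using mono_of_eq_iff[of xs "[]"] by simp

lemma single_eq_mono_poly: "Poly_Mapping.single (mono_of xs) u = pconst u * mono_poly xs"
  by (simp add: mono_poly_eq pconst_def mult_single)

text \<open>Everything below uses the axioms of the product only through these two facts.\<close>

locale bac_rule =
  fixes P :: "pv trm" and a b c :: rat
  assumes bac: "b * b = b + a * c"
    and peval_rule: "\<And>\<sigma>. peval \<sigma> P = pconst a * (\<sigma> PX * \<sigma> PY)
      + pconst b * (\<sigma> PX * \<sigma> PYd + \<sigma> PXd * \<sigma> PY) + pconst c * (\<sigma> PXd * \<sigma> PYd)"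
begin

definition rule_poly :: "Defs.poly \<Rightarrow> Defs.poly \<Rightarrow> Defs.poly \<Rightarrow> Defs.poly \<Rightarrow> Defs.poly" where
  "rule_poly p p' q q' = pconst a * (p * q) + pconst b * (p * q' + p' * q) + pconst c * (p' * q')"

lemma peval_ppval: "peval (ppval p p' q q') P = rule_poly p p' q q'"
  by (simp add: peval_rule ppval_def rule_poly_def)

lemma rule_poly_commute: "rule_poly p p' q q' = rule_poly q q' p p'"
  by (simp add: rule_poly_def algebra_simps)

text \<open>The defect of associativity is a multiple of \<open>b + a * c - b * b\<close>, as
  computed in the second claim, and so vanishes by \<open>bac\<close>.\<close>

lemma rule_poly_assoc:
  "rule_poly p p' (q * r) (rule_poly q q' r r') = rule_poly (p * q) (rule_poly p p' q q') r r'"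
proof -
  have "pconst b * pconst b = pconst b + pconst a * pconst c"
    using bac by (simp flip: pconst_simps)
  then have "pconst b + pconst a * pconst c - pconst b * pconst b = 0" by simp
  moreover have "rule_poly p p' (q * r) (rule_poly q q' r r') - rule_poly (p * q) (rule_poly p p' q q') r r'
    = (pconst b + pconst a * pconst c - pconst b * pconst b) * (p' * q * r - p * q * r')"
    unfolding rule_poly_def by (simp add: algebra_simps)
  ultimately show ?thesis by simp
qed

lemma rule_poly_add: "rule_poly (p1 + p2) (p1' + p2') q q' = rule_poly p1 p1' q q' + rule_poly p2 p2' q q'"
  by (simp add: rule_poly_def algebra_simps)

lemma rule_poly_zero [simp]: "rule_poly 0 0 q q' = 0"
  by (simp add: rule_poly_def)

text \<open>Products are bracketed to the right. Singletons need an equation of their own because 1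
  is not in \<open>Q0\<close> and cannot serve as a base case for the rule. The value 0 at
  \<open>[]\<close> sends constants to 0, so that images lie in \<open>Q0\<close> for every
  polynomial.\<close>

fun mono_ext :: "(nat \<Rightarrow> Defs.poly) \<Rightarrow> nat list \<Rightarrow> Defs.poly" where
  "mono_ext D [] = 0"
| "mono_ext D [x] = D x"
| "mono_ext D (x # y # ys) = rule_poly (pvar x) (D x) (mono_poly (y # ys)) (mono_ext D (y # ys))"

lemma mono_ext_Cons:
  "ys \<noteq> [] \<Longrightarrow> mono_ext D (x # ys) = rule_poly (pvar x) (D x) (mono_poly ys) (mono_ext D ys)"
  by (cases ys) auto

text \<open>Associativity moves the bracket. Empty parts are excluded because the rule with second
  factor 1 and derivative 0 gives \<open>a * p + b * p'\<close>, not \<open>p'\<close>.\<close>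

lemma mono_ext_append:
  assumes "xs \<noteq> []" "ys \<noteq> []"
  shows "mono_ext D (xs @ ys) = rule_poly (mono_poly xs) (mono_ext D xs) (mono_poly ys) (mono_ext D ys)"
  using assms
proof (induction xs rule: list_nonempty_induct)
  case (single x)
  then show ?case by (simp add: mono_ext_Cons)
next
  case (cons x xs)
  then show ?case by (simp add: mono_ext_Cons rule_poly_assoc)
qed

text \<open>Makes the extension well defined on monomials. By commutativity
  \<open>us @ x # vs\<close> may be rotated to \<open>x # vs @ us\<close>, which reduces a
  permutation to one of the tails.\<close>

lemma mono_ext_mset: "mset xs = mset ys \<Longrightarrow> mono_ext D xs = mono_ext D ys"
proof (induction xs arbitrary: ys)
  case (Cons x xs)
  have "x \<in> set ys" using Cons.prems by (metis list.set_intros(1) set_mset_mset)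
  then obtain us vs where ys: "ys = us @ x # vs" by (meson split_list)
  have "mset xs = mset (vs @ us)" using Cons.prems ys by simp
  then have IH: "mono_ext D xs = mono_ext D (vs @ us)" "mono_of xs = mono_of (vs @ us)"
    using Cons.IH mono_of_eq_iff by blast+
  have "mono_ext D ys = mono_ext D (x # vs @ us)"
    using mono_ext_append[of us "x # vs" D] mono_ext_append[of "x # vs" us D]
    unfolding ys by (cases "us = []") (auto simp: rule_poly_commute)
  also have "\<dots> = mono_ext D (x # xs)"
  proof (cases "xs = []")
    case True
    then have "vs @ us = []" using \<open>mset xs = mset (vs @ us)\<close> by (metis mset_zero_iff)
    then show ?thesis using True by simp
  next
    case False
    then have "vs @ us \<noteq> []" using \<open>mset xs = mset (vs @ us)\<close> by (metis mset_zero_iff)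
    then show ?thesis
      using mono_ext_Cons[of "vs @ us" D x] mono_ext_Cons[OF False, of D x] IH mono_poly_eq by metis
  qed
  finally show ?case by simp
qed simp

text \<open>Linear extension from monomials; the choice of the presenting list is harmless by
  \<open>mono_ext_mset\<close>.\<close>

definition rule_ext :: "(nat \<Rightarrow> Defs.poly) \<Rightarrow> Defs.poly \<Rightarrow> Defs.poly" where
  "rule_ext D p = (\<Sum>m\<in>Poly_Mapping.keys p.
     pconst (Poly_Mapping.lookup p m) * mono_ext D (SOME xs. mono_of xs = m))"

lemma rule_ext_zero [simp]: "rule_ext D 0 = 0"
  by (simp add: rule_ext_def)

lemma rule_ext_add: "rule_ext D (p + q) = rule_ext D p + rule_ext D q"
  unfolding rule_ext_def
  by (rule setsum_keys_plus_distrib) (auto simp: pconst_simps algebra_simps)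

lemma rule_ext_mono: "rule_ext D (pconst u * mono_poly xs) = pconst u * mono_ext D xs"
proof -
  have "mono_of (SOME ys. mono_of ys = mono_of xs) = mono_of xs" by (rule someI) simp
  then have "mono_ext D (SOME ys. mono_of ys = mono_of xs) = mono_ext D xs"
    using mono_of_eq_iff mono_ext_mset by blast
  then show ?thesis
    unfolding single_eq_mono_poly[symmetric] rule_ext_def by (cases "u = 0") (auto simp: pconst_simps)
qed

lemma rule_ext_scale: "rule_ext D (pconst u * p) = pconst u * rule_ext D p"
proof (induction p rule: poly_mapping_induct_single)
  case (single m v)
  obtain xs where "m = mono_of xs" using mono_of_surj by metis
  then show ?case
    using rule_ext_mono[of D "u * v" xs] rule_ext_mono[of D v xs]
    by (simp add: single_eq_mono_poly pconst_simps mult.assoc)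
qed (auto simp: rule_ext_add algebra_simps)

lemma rule_ext_diff: "rule_ext D (p - q) = rule_ext D p - rule_ext D q"
  using rule_ext_add[of D "p - q" q] by simp

lemma rule_ext_pvar: "rule_ext D (pvar x) = D x"
  using rule_ext_mono[of D 1 "[x]"] by (simp add: pconst_simps)

text \<open>Both sides are bilinear, so monomials suffice, where the claim is
  \<open>mono_ext_append\<close>; membership in \<open>Q0\<close> keeps the presenting lists
  nonempty.\<close>

lemma rule_ext_mult:
  assumes "p \<in> Q0" "q \<in> Q0"
  shows "rule_ext D (p * q) = rule_poly p (rule_ext D p) q (rule_ext D q)"
proof (induction p rule: poly_mapping_induct_single)
  case (single m u)
  then have "m \<noteq> 0" using assms(1) by (auto simp: Q0_def in_keys_iff)
  then obtain xs where m: "m = mono_of xs" "xs \<noteq> []" using mono_of_surj mono_of_eq_0_iff by metis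
  show ?case
  proof (induction q rule: poly_mapping_induct_single)
    case (single n v)
    then have "n \<noteq> 0" using assms(2) by (auto simp: Q0_def in_keys_iff)
    then obtain ys where n: "n = mono_of ys" "ys \<noteq> []" using mono_of_surj mono_of_eq_0_iff by metis
    have "Poly_Mapping.single m u * Poly_Mapping.single n v = pconst (u * v) * mono_poly (xs @ ys)"
      by (simp add: m n single_eq_mono_poly pconst_simps mult_ac)
    then have "rule_ext D (Poly_Mapping.single m u * Poly_Mapping.single n v) =
        pconst (u * v) * rule_poly (mono_poly xs) (mono_ext D xs) (mono_poly ys) (mono_ext D ys)"
      by (simp only: rule_ext_mono mono_ext_append[OF m(2) n(2)])
    also have "\<dots> = rule_poly (pconst u * mono_poly xs) (pconst u * mono_ext D xs)
        (pconst v * mono_poly ys) (pconst v * mono_ext D ys)"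
      by (simp add: rule_poly_def pconst_simps algebra_simps)
    finally show ?case by (simp add: m n single_eq_mono_poly rule_ext_mono)
  next
    case (add q1 q2)
    then show ?case
      by (simp add: distrib_left rule_ext_add)
        (metis rule_poly_add rule_poly_commute)
  qed (simp add: rule_poly_def)
next
  case (add p1 p2)
  then show ?case by (simp add: distrib_right rule_ext_add rule_poly_add)
qed simp

lemma mono_ext_Q0:
  assumes "\<And>x. x \<in> set xs \<Longrightarrow> D x \<in> Q0"
  shows "mono_ext D xs \<in> Q0"
  using assms
  by (induction D xs rule: mono_ext.induct) (auto simp: rule_poly_def Q0_iff_evalp)

lemma rule_ext_Q0:
  assumes "\<And>x. D x \<in> Q0"
  shows "rule_ext D p \<in> Q0"
proof (induction p rule: poly_mapping_induct_single)
  case (single m u)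
  obtain xs where "m = mono_of xs" using mono_of_surj by metis
  then show ?case by (simp add: single_eq_mono_poly rule_ext_mono Q0_closed mono_ext_Q0 assms)
qed (auto simp: rule_ext_add Q0_closed)

lemma ext_ok_unique:
  assumes E: "ext_ok P D E" and p: "p \<in> Q0"
  shows "E p = rule_ext D p"
proof -
  have mono: "E (mono_poly xs) = mono_ext D xs" if "xs \<noteq> []" for xs
    using that
  proof (induction xs rule: list_nonempty_induct)
    case (single x)
    then show ?case using E by (simp add: ext_ok_def)
  next
    case (cons x xs)
    then show ?case using E by (simp add: ext_ok_def Q0_closed mono_poly_Q0 peval_ppval mono_ext_Cons)
  qed
  \<comment> \<open>Membership in \<open>Q0\<close> is carried along because \<open>E\<close> is
    known to be additive only there.\<close>
  have "p \<in> Q0 \<and> E p = rule_ext D p"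
  proof (induction p rule: poly_mapping_induct_single)
    case zero
    have "E (pconst 0 * 0) = pconst 0 * E 0" using E Q0_closed(1) unfolding ext_ok_def by blast
    then show ?case by (simp add: pconst_simps Q0_closed)
  next
    case (single m u)
    then have "m \<noteq> 0" using p by (auto simp: Q0_def in_keys_iff)
    then obtain xs where m: "m = mono_of xs" "xs \<noteq> []" using mono_of_surj mono_of_eq_0_iff by metis
    then show ?case using E mono[OF m(2)]
      by (simp add: single_eq_mono_poly rule_ext_mono ext_ok_def mono_poly_Q0 Q0_closed)
  next
    case (add q r)
    then show ?case using E by (simp add: ext_ok_def rule_ext_add Q0_closed)
  qed
  then show ?thesis by simp
qed

text \<open>Resolves the definite description in \<open>ext\<close>: \<open>rule_ext\<close> cut off
  to 0 outside \<open>Q0\<close> exists, and \<open>ext_ok_unique\<close> excludes any other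
  candidate.\<close>

lemma ext_eq_rule_ext:
  assumes "\<And>x. D x \<in> Q0" "p \<in> Q0"
  shows "ext P D p = rule_ext D p"
proof -
  let ?E = "\<lambda>p. if p \<in> Q0 then rule_ext D p else 0"
  have ok: "ext_ok P D ?E"
    unfolding ext_ok_def
    by (auto simp: rule_ext_Q0 assms(1) Q0_closed rule_ext_add rule_ext_scale rule_ext_pvar
        rule_ext_mult peval_ppval)
  have "ext P D = ?E" unfolding ext_def
  proof (rule the_equality)
    fix E assume "ext_ok P D E \<and> (\<forall>p. p \<notin> Q0 \<longrightarrow> E p = 0)"
    then show "E = ?E" using ext_ok_unique[of D E] by (auto simp: fun_eq_iff)
  qed (use ok in auto)
  then show ?thesis using assms(2) by simp
qed

end

section \<open>Hilbert's basis theorem\<close>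

text \<open>Noetherianity is stated for subrings of a fixed ring, so that the basis theorem can be
  iterated over the variables.\<close>

inductive_set span_over :: "'a::comm_ring_1 set \<Rightarrow> 'a set \<Rightarrow> 'a set" for R S where
  span_over_zero: "0 \<in> span_over R S"
| span_over_step: "r \<in> R \<Longrightarrow> s \<in> S \<Longrightarrow> x \<in> span_over R S \<Longrightarrow> r * s + x \<in> span_over R S"

definition subring_set :: "'a::comm_ring_1 set \<Rightarrow> bool" where
  "subring_set R \<longleftrightarrow> 1 \<in> R \<and> (\<forall>x\<in>R. - x \<in> R) \<and> (\<forall>x\<in>R. \<forall>y\<in>R. x + y \<in> R \<and> x * y \<in> R)"

text \<open>Phrased for generating sets, with the finitely many generators taken from
  \<open>S\<close> itself: the generators must later be derivatives along words, not arbitrary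
  elements of the ideal.\<close>

definition noetherian_set :: "'a::comm_ring_1 set \<Rightarrow> bool" where
  "noetherian_set R \<longleftrightarrow> (\<forall>S\<subseteq>R. \<exists>S0\<subseteq>S. finite S0 \<and> S \<subseteq> span_over R S0)"

lemma subring_setD:
  assumes "subring_set R"
  shows "1 \<in> R" "0 \<in> R" "x \<in> R \<Longrightarrow> - x \<in> R" "x \<in> R \<Longrightarrow> y \<in> R \<Longrightarrow> x + y \<in> R"
    "x \<in> R \<Longrightarrow> y \<in> R \<Longrightarrow> x * y \<in> R"
proof -
  have "1 + - 1 \<in> R" using assms unfolding subring_set_def by blast
  then show "0 \<in> R" by simp
qed (use assms in \<open>auto simp: subring_set_def\<close>)

lemma subring_UNIV: "subring_set UNIV"
  by (simp add: subring_set_def)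

lemma subring_set_sum:
  assumes "subring_set R" "\<And>i. i \<in> A \<Longrightarrow> f i \<in> R"
  shows "sum f A \<in> R"
  using assms by (induction A rule: infinite_finite_induct) (auto intro: subring_setD)

lemma span_over_base: "subring_set R \<Longrightarrow> s \<in> S \<Longrightarrow> s \<in> span_over R S"
  using span_over_step[of 1 R s S 0] by (auto intro: span_over_zero subring_setD)

lemma span_over_add: "x \<in> span_over R S \<Longrightarrow> y \<in> span_over R S \<Longrightarrow> x + y \<in> span_over R S"
  by (induction rule: span_over.induct) (auto simp: add.assoc intro: span_over.intros)

lemma span_over_mult:
  assumes "subring_set R" "r \<in> R" "x \<in> span_over R S"
  shows "r * x \<in> span_over R S"
  using assms(3)
proof (induction rule: span_over.induct)
  case (span_over_step t s x)
  have "(r * t) * s + r * x \<in> span_over R S"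
    using span_over_step assms(1,2) by (intro span_over.intros(2)) (auto intro: subring_setD)
  then show ?case by (simp add: algebra_simps)
qed (auto intro: span_over_zero)

lemma span_over_diff:
  assumes "subring_set R" "x \<in> span_over R S" "y \<in> span_over R S"
  shows "x - y \<in> span_over R S"
  using span_over_add[OF assms(2) span_over_mult[OF assms(1) _ assms(3), of "- 1"]]
    subring_setD(1,3)[OF assms(1)] by simp

lemma span_over_trans:
  assumes "subring_set R" "S \<subseteq> span_over R S'" "x \<in> span_over R S"
  shows "x \<in> span_over R S'"
  using assms(3)
  by (induction rule: span_over.induct)
    (use assms(1,2) in \<open>auto intro: span_over_zero span_over_add span_over_mult\<close>)

lemma span_over_mono:
  assumes "R \<subseteq> R'" "S \<subseteq> S'" "x \<in> span_over R S"
  shows "x \<in> span_over R' S'"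
  using assms(3) by (induction rule: span_over.induct) (use assms(1,2) in \<open>auto intro: span_over.intros\<close>)

lemma span_over_finite_support:
  assumes "x \<in> span_over R S"
  shows "\<exists>S0\<subseteq>S. finite S0 \<and> x \<in> span_over R S0"
  using assms
proof (induction rule: span_over.induct)
  case (span_over_step r s x)
  then obtain S0 where S0: "S0 \<subseteq> S" "finite S0" "x \<in> span_over R S0" by blast
  have "r * s + x \<in> span_over R (insert s S0)"
    using span_over_step S0 by (intro span_over.intros(2)) (auto intro: span_over_mono[of R R S0])
  then show ?case using S0 span_over_step by (intro exI[of _ "insert s S0"]) auto
qed (auto intro: span_over_zero)

definition polys_over :: "'a::comm_ring_1 set \<Rightarrow> 'a Polynomial.poly set" where
  "polys_over R = {p. \<forall>i. coeff p i \<in> R}"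

lemma subring_polys_over: "subring_set R \<Longrightarrow> subring_set (polys_over R)"
  unfolding subring_set_def[of "polys_over R"]
  by (auto simp: polys_over_def coeff_mult intro!: subring_set_sum subring_setD)

text \<open>Choosing elements of minimal degree outside the ideal generated so far, the first leading
  coefficient that depends on its predecessors yields a contradiction.\<close>

lemma noetherian_polys_over:
  assumes R: "subring_set R" and noeth: "noetherian_set R"
  shows "noetherian_set (polys_over R)"
  unfolding noetherian_set_def
proof (intro allI impI, rule ccontr)
  fix S assume S: "S \<subseteq> polys_over R"
  let ?P = "polys_over R"
  assume no: "\<not> (\<exists>S0\<subseteq>S. finite S0 \<and> S \<subseteq> span_over ?P S0)"
  have P: "subring_set ?P" using R by (rule subring_polys_over)
  let ?I = "span_over ?P S"
  have IP: "x \<in> ?P" if "x \<in> ?I" for x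
    using that by (induction rule: span_over.induct) (use S subring_setD[OF P] in auto)
  \<comment> \<open>Otherwise each element of \<open>T\<close> could be replaced by the finitely
    many members of \<open>S\<close> that generate it, giving the excluded finite subset of
    \<open>S\<close>.\<close>
  have notin: "\<exists>x\<in>?I. x \<notin> span_over ?P T" if T: "finite T" "T \<subseteq> ?I" for T
  proof (rule ccontr)
    assume "\<not> ?thesis"
    then have S_sub: "S \<subseteq> span_over ?P T" using span_over_base[OF P] by blast
    have "\<forall>t\<in>T. \<exists>S0\<subseteq>S. finite S0 \<and> t \<in> span_over ?P S0"
      using T span_over_finite_support by blast
    then obtain A where A: "\<And>t. t \<in> T \<Longrightarrow> A t \<subseteq> S \<and> finite (A t) \<and> t \<in> span_over ?P (A t)" by metis
    have "T \<subseteq> span_over ?P (\<Union>t\<in>T. A t)"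
      using A by (auto intro: span_over_mono[of ?P ?P "A _"])
    then have "S \<subseteq> span_over ?P (\<Union>t\<in>T. A t)" using S_sub span_over_trans[OF P] by blast
    moreover have "finite (\<Union>t\<in>T. A t)" "(\<Union>t\<in>T. A t) \<subseteq> S" using A T by auto
    ultimately show False using no by blast
  qed
  define good where "good T x \<longleftrightarrow> x \<in> ?I \<and> x \<notin> span_over ?P T \<and>
      (\<forall>y\<in>?I. y \<notin> span_over ?P T \<longrightarrow> degree x \<le> degree y)" for T x
  have "\<exists>x. good T x" if "finite T" "T \<subseteq> ?I" for T
    using ex_has_least_nat[of "\<lambda>x. x \<in> ?I \<and> x \<notin> span_over ?P T" _ degree] notin[OF that]
    unfolding good_def by blast
  then obtain pick where pick: "\<And>T. finite T \<Longrightarrow> T \<subseteq> ?I \<Longrightarrow> good T (pick T)" by metis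
  define T where "T = rec_nat {} (\<lambda>i A. insert (pick A) A)"
  define f where "f n = pick (T n)" for n
  have T_simps: "T 0 = {}" "T (Suc n) = insert (f n) (T n)" for n by (auto simp: T_def f_def)
  have T_fin: "finite (T n) \<and> T n \<subseteq> ?I" for n
    by (induction n) (use pick in \<open>auto simp: T_simps f_def good_def\<close>)
  then have f: "good (T n) (f n)" for n unfolding f_def using pick by blast
  have T_eq: "T n = f ` {..<n}" for n by (induction n) (auto simp: T_simps lessThan_Suc)
  define a where "a n = lead_coeff (f n)" for n
  have "range a \<subseteq> R" using f IP by (auto simp: a_def good_def polys_over_def)
  then obtain S0 where S0: "S0 \<subseteq> range a" "finite S0" "range a \<subseteq> span_over R S0"
    using noeth unfolding noetherian_set_def by metis
  obtain N where N: "finite N" "S0 = a ` N" using S0 finite_subset_image by metis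
  \<comment> \<open>Beyond every index in \<open>N\<close>, so that the leading coefficient of
    \<open>f m\<close> depends on its predecessors; inserting 0 keeps \<open>Max\<close> meaningful
    for empty \<open>N\<close>.\<close>
  define m where "m = Suc (Max (insert 0 N))"
  have "N \<subseteq> {..<m}" using N unfolding m_def by (auto simp: less_Suc_eq_le)
  then have am: "a m \<in> span_over R (a ` {..<m})"
    using S0 N span_over_mono[of R R S0 "a ` {..<m}"] by blast
  define d where "d = degree (f m)"
  \<comment> \<open>When \<open>f j\<close> was chosen, \<open>f m\<close> was already a candidate,
    so minimality compares the degrees.\<close>
  have deg: "degree (f j) \<le> d" if "j < m" for j
  proof -
    have "T j \<subseteq> T m" using that by (auto simp: T_eq)
    then have "f m \<notin> span_over ?P (T j)" using f[of m] span_over_mono[of ?P ?P "T j" "T m"]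
      unfolding good_def by blast
    then show ?thesis using f[of j] f[of m] unfolding good_def d_def by blast
  qed
  \<comment> \<open>Multiplying each predecessor by a power of the variable lifts it to degree
    \<open>d\<close>, which copies a combination of leading coefficients to the coefficient at
    \<open>d\<close>.\<close>
  have "\<exists>g\<in>span_over ?P (T m). degree g \<le> d \<and> coeff g d = x" if "x \<in> span_over R (a ` {..<m})" for x
    using that
  proof (induction rule: span_over.induct)
    case span_over_zero
    show ?case by (rule bexI[of _ 0]) (auto intro: span_over.intros)
  next
    case (span_over_step r s x)
    obtain j where j: "j < m" "s = a j" using span_over_step by auto
    obtain g where g: "g \<in> span_over ?P (T m)" "degree g \<le> d" "coeff g d = x" using span_over_step by auto
    let ?g = "monom r (d - degree (f j)) * f j"
    have "degree ?g \<le> d"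
      using degree_mult_le[of "monom r (d - degree (f j))" "f j"] degree_monom_le[of r "d - degree (f j)"]
        deg[OF j(1)] by linarith
    moreover have "coeff ?g d = r * s"
      using deg[OF j(1)] by (simp add: coeff_monom_mult j(2) a_def)
    moreover have "monom r (d - degree (f j)) \<in> ?P"
      using span_over_step(1) subring_setD(2)[OF R] by (auto simp: polys_over_def)
    then have "?g + g \<in> span_over ?P (T m)"
      using j g(1) by (intro span_over.intros(2)) (auto simp: T_eq)
    ultimately show ?case using g(2,3)
      by (intro bexI[of _ "?g + g"]) (auto intro: degree_add_le)
  qed
  from this[OF am] obtain g where g: "g \<in> span_over ?P (T m)" "degree g \<le> d" "coeff g d = a m" by blast
  \<comment> \<open>The coefficient at \<open>d\<close> cancels while \<open>h\<close> stays outside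
    the span; minimality of \<open>d\<close> then leaves only \<open>h = 0\<close>, which lies in
    the span.\<close>
  define h where "h = f m - g"
  have fm: "f m \<in> ?I" "f m \<notin> span_over ?P (T m)" using f[of m] by (auto simp: good_def)
  have "T m \<subseteq> ?I" using T_fin by simp
  then have "g \<in> ?I" using g(1) by (rule span_over_trans[OF P])
  then have "h \<in> ?I" unfolding h_def by (rule span_over_diff[OF P fm(1)])
  moreover have h_notin: "h \<notin> span_over ?P (T m)"
    using fm(2) span_over_add[OF _ g(1), of h] by (auto simp: h_def)
  ultimately have "d \<le> degree h" using f[of m] unfolding good_def d_def by blast
  moreover have "degree h \<le> d" unfolding h_def using g(2) by (intro degree_diff_le) (auto simp: d_def)
  moreover have "coeff h d = 0" using g(3) by (simp add: h_def d_def a_def)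
  ultimately have "h = 0" by (metis antisym leading_coeff_0_iff)
  then show False using h_notin span_over_zero by blast
qed

text \<open>The ring R[t] inside the ambient ring, as the image of evaluation at \<open>t\<close>.
  No algebraic independence enters: images of noetherian rings are noetherian.\<close>

definition adjoin :: "'a::comm_ring_1 set \<Rightarrow> 'a \<Rightarrow> 'a set" where
  "adjoin R t = (\<lambda>p. poly p t) ` polys_over R"

lemma subring_adjoin:
  assumes "subring_set R"
  shows "subring_set (adjoin R t)"
proof -
  note D = subring_setD[OF subring_polys_over[OF assms]]
  show ?thesis unfolding subring_set_def adjoin_def ball_simps
  proof (intro conjI ballI)
    show "1 \<in> (\<lambda>p. poly p t) ` polys_over R" by (rule image_eqI[of _ _ 1]) (auto intro: D)
    fix p assume p: "p \<in> polys_over R"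
    show "- poly p t \<in> (\<lambda>p. poly p t) ` polys_over R"
      by (rule image_eqI[of _ _ "- p"]) (auto intro: D p)
    fix q assume q: "q \<in> polys_over R"
    show "poly p t + poly q t \<in> (\<lambda>p. poly p t) ` polys_over R"
      by (rule image_eqI[of _ _ "p + q"]) (auto intro: D p q)
    show "poly p t * poly q t \<in> (\<lambda>p. poly p t) ` polys_over R"
      by (rule image_eqI[of _ _ "p * q"]) (auto intro: D p q)
  qed
qed

text \<open>Pull \<open>S\<close> back along evaluation, choose finitely many generators among the
  preimages, and push them forward.\<close>

lemma noetherian_adjoin:
  assumes "subring_set R" "noetherian_set R"
  shows "noetherian_set (adjoin R t)"
  unfolding noetherian_set_def
proof (intro allI impI)
  fix S assume S: "S \<subseteq> adjoin R t"
  let ?e = "\<lambda>p. poly p t"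
  define S' where "S' = {p \<in> polys_over R. ?e p \<in> S}"
  obtain S0 where S0: "S0 \<subseteq> S'" "finite S0" "S' \<subseteq> span_over (polys_over R) S0"
    using noetherian_polys_over[OF assms] unfolding noetherian_set_def S'_def
    by (metis (no_types, lifting) mem_Collect_eq subsetI)
  have "?e p \<in> span_over (adjoin R t) (?e ` S0)" if "p \<in> span_over (polys_over R) S0" for p
    using that by (induction rule: span_over.induct)
      (auto intro: span_over_zero span_over_step simp: adjoin_def)
  then have "S \<subseteq> span_over (adjoin R t) (?e ` S0)"
    using S S0(3) by (auto simp: adjoin_def S'_def)
  moreover have "?e ` S0 \<subseteq> S" "finite (?e ` S0)" using S0(1,2) by (auto simp: S'_def)
  ultimately show "\<exists>S0\<subseteq>S. finite S0 \<and> S \<subseteq> span_over (adjoin R t) S0" by blast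
qed

lemma adjoin_mono: "R \<subseteq> adjoin R t" if "subring_set R"
proof
  fix x assume "x \<in> R"
  then show "x \<in> adjoin R t"
    unfolding adjoin_def using subring_setD(2)[OF that]
    by (intro image_eqI[of _ _ "[:x:]"]) (auto simp: polys_over_def coeff_pCons split: nat.split)
qed

lemma adjoin_self: "t \<in> adjoin R t" if "subring_set R"
  unfolding adjoin_def using subring_setD(1,2)[OF that]
  by (intro image_eqI[of _ _ "[:0, 1:]"]) (auto simp: polys_over_def coeff_pCons split: nat.split)

primrec poly_ring_below :: "nat \<Rightarrow> Defs.poly set" where
  "poly_ring_below 0 = range pconst"
| "poly_ring_below (Suc n) = adjoin (poly_ring_below n) (pvar n)"

lemma subring_poly_ring_below: "subring_set (poly_ring_below n)"
proof (induction n)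
  case 0
  show ?case unfolding subring_set_def poly_ring_below.simps
    by (auto simp: pconst_simps(3-5)[symmetric] simp flip: pconst_simps(2))
qed (simp add: subring_adjoin)

lemma noetherian_poly_ring_below: "noetherian_set (poly_ring_below n)"
proof (induction n)
  case 0
  show ?case unfolding noetherian_set_def
  proof (intro allI impI)
    fix S assume S: "S \<subseteq> poly_ring_below 0"
    show "\<exists>S0\<subseteq>S. finite S0 \<and> S \<subseteq> span_over (poly_ring_below 0) S0"
    proof (cases "S \<subseteq> {0}")
      case True
      then show ?thesis by (intro exI[of _ "{}"]) (auto intro: span_over_zero)
    next
      case False
      then obtain x where x: "x \<in> S" "x \<noteq> 0" by blast
      then obtain c where "x = pconst c" using S by auto
      then have c: "pconst c \<in> S" "c \<noteq> 0" using x pconst_simps(1) by auto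
      have "pconst d \<in> span_over (poly_ring_below 0) {pconst c}" for d
        using span_over_step[of "pconst (d / c)" "poly_ring_below 0" "pconst c" "{pconst c}" 0] c(2)
        by (auto simp: span_over_zero simp flip: pconst_simps(4))
      then show ?thesis using S c by (intro exI[of _ "{pconst c}"]) auto
    qed
  qed
qed (simp add: noetherian_adjoin subring_poly_ring_below)

lemma pconst_in_poly_ring_below: "pconst c \<in> poly_ring_below n"
  by (induction n) (use adjoin_mono[OF subring_poly_ring_below] in auto)

lemma pvar_in_poly_ring_below: "i < n \<Longrightarrow> pvar i \<in> poly_ring_below n"
proof (induction n)
  case (Suc n)
  then show ?case
    using adjoin_mono[OF subring_poly_ring_below, of n "pvar n"]
      adjoin_self[OF subring_poly_ring_below, of "pvar n" n] by (cases "i = n") auto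
qed simp

section \<open>Computing with polynomials as lists\<close>

text \<open>The triple \<open>((m, n), d)\<close> stands for the rational \<open>(m - n) / (d + 1)\<close>, so every triple is valid.\<close>

type_synonym frac = "(nat \<times> nat) \<times> nat"

definition frac_val :: "frac \<Rightarrow> rat" where
  "frac_val q = (of_nat (fst (fst q)) - of_nat (snd (fst q))) / of_nat (Suc (snd q))"

definition frac_add :: "frac \<Rightarrow> frac \<Rightarrow> frac" where
  "frac_add q r = ((fst (fst q) * Suc (snd r) + fst (fst r) * Suc (snd q),
     snd (fst q) * Suc (snd r) + snd (fst r) * Suc (snd q)), Suc (snd q) * Suc (snd r) - 1)"

definition frac_mult :: "frac \<Rightarrow> frac \<Rightarrow> frac" where
  "frac_mult q r = ((fst (fst q) * fst (fst r) + snd (fst q) * snd (fst r),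
     fst (fst q) * snd (fst r) + snd (fst q) * fst (fst r)), Suc (snd q) * Suc (snd r) - 1)"

definition frac_zero :: frac where "frac_zero = ((0, 0), 0)"
definition frac_one :: frac where "frac_one = ((1, 0), 0)"
definition frac_neg_one :: frac where "frac_neg_one = ((0, 1), 0)"

definition frac_is_zero :: "frac \<Rightarrow> bool" where
  "frac_is_zero q \<longleftrightarrow> fst (fst q) = snd (fst q)"

lemma frac_val_simps [simp]:
  "frac_val (frac_add q r) = frac_val q + frac_val r"
  "frac_val (frac_mult q r) = frac_val q * frac_val r"
  "frac_val frac_zero = 0" "frac_val frac_one = 1" "frac_val frac_neg_one = - 1"
proof -
  \<comment> \<open>Denominators are stored as predecessors; a product of successors is positive, so
    the truncated subtraction is exact.\<close>
  have den: "(of_nat (Suc (Suc m * Suc n - 1)) :: rat) = of_nat (Suc m) * of_nat (Suc n)" for m n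
    by (simp add: algebra_simps)
  have nz: "(of_nat (Suc n) :: rat) \<noteq> 0" for n by (simp only: of_nat_eq_0_iff)
  show "frac_val (frac_add q r) = frac_val q + frac_val r"
    unfolding frac_val_def frac_add_def fst_conv snd_conv den of_nat_add of_nat_mult
    using nz[of "snd q"] nz[of "snd r"] by (simp add: divide_simps del: of_nat_Suc) (simp add: algebra_simps)
  show "frac_val (frac_mult q r) = frac_val q * frac_val r"
    unfolding frac_val_def frac_mult_def fst_conv snd_conv den of_nat_add of_nat_mult
    using nz[of "snd q"] nz[of "snd r"] by (simp add: divide_simps del: of_nat_Suc) (simp add: algebra_simps)
qed (simp_all add: frac_val_def frac_zero_def frac_one_def frac_neg_one_def)

lemma frac_is_zero_iff: "frac_is_zero q \<longleftrightarrow> frac_val q = 0"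
  unfolding frac_is_zero_def frac_val_def by (simp del: of_nat_Suc)

lemma frac_val_surj: "\<exists>q. frac_val q = r"
proof -
  obtain i j where ij: "quotient_of r = (i, j)" by fastforce
  have j: "j > 0" using quotient_of_denom_pos[OF ij] .
  have "frac_val ((nat i, nat (- i)), nat j - 1) = of_int i / of_int j"
  proof -
    have "Suc (nat j - 1) = nat j" using j by simp
    then have d: "(of_nat (Suc (nat j - 1)) :: rat) = of_int j" using j by (simp del: of_nat_Suc)
    have "(of_nat (nat i) :: rat) - of_nat (nat (- i)) = of_int i" by (cases "i \<ge> 0") auto
    then show ?thesis unfolding frac_val_def fst_conv snd_conv d by simp
  qed
  then show ?thesis using quotient_of_div[OF ij] by auto
qed

lemma computable_frac [computable_intros]:
  assumes "computable f" "computable g"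
  shows "computable (\<lambda>x. frac_add (f x) (g x))" "computable (\<lambda>x. frac_mult (f x) (g x))"
  unfolding frac_add_def frac_mult_def by (intro computable_intros assms)+

lemma decidable_frac_is_zero [computable_intros]:
  "computable f \<Longrightarrow> decidable (\<lambda>x. frac_is_zero (f x))"
  unfolding frac_is_zero_def by (intro computable_intros)

definition frac_sum :: "frac list \<Rightarrow> frac" where "frac_sum qs = foldr frac_add qs frac_zero"
definition frac_prod :: "frac list \<Rightarrow> frac" where "frac_prod qs = foldr frac_mult qs frac_one"

lemma frac_val_sum: "frac_val (frac_sum qs) = sum_list (map frac_val qs)"
  unfolding frac_sum_def by (induction qs) auto

lemma frac_val_prod: "frac_val (frac_prod qs) = prod_list (map frac_val qs)"
  unfolding frac_prod_def by (induction qs) auto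

lemma computable_frac_sum [computable_intros]:
  "computable f \<Longrightarrow> computable (\<lambda>x. frac_sum (f x))"
  unfolding frac_sum_def foldr_conv_fold by (intro computable_intros)

lemma computable_frac_prod [computable_intros]:
  "computable f \<Longrightarrow> computable (\<lambda>x. frac_prod (f x))"
  unfolding frac_prod_def foldr_conv_fold by (intro computable_intros)

text \<open>A list of coefficients and monomials stands for their sum; monomials are lists of variables
  and may be repeated.\<close>

type_synonym lpoly = "(frac \<times> nat list) list"

definition lsem :: "lpoly \<Rightarrow> Defs.poly" where
  "lsem L = sum_list (map (\<lambda>t. pconst (frac_val (fst t)) * mono_poly (snd t)) L)"

definition lscale :: "frac \<Rightarrow> lpoly \<Rightarrow> lpoly" where
  "lscale q L = map (\<lambda>t. (frac_mult q (fst t), snd t)) L"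

definition lmult :: "lpoly \<Rightarrow> lpoly \<Rightarrow> lpoly" where
  "lmult L M = concat (map (\<lambda>t. map (\<lambda>u. (frac_mult (fst t) (fst u), snd t @ snd u)) M) L)"

definition lvar :: "nat \<Rightarrow> lpoly" where "lvar x = [(frac_one, [x])]"

lemma lsem_Nil [simp]: "lsem [] = 0"
  by (simp add: lsem_def)

lemma lsem_Cons [simp]: "lsem (t # L) = pconst (frac_val (fst t)) * mono_poly (snd t) + lsem L"
  by (simp add: lsem_def)

lemma lsem_append [simp]: "lsem (L @ M) = lsem L + lsem M"
  by (simp add: lsem_def)

lemma lsem_lscale [simp]: "lsem (lscale q L) = pconst (frac_val q) * lsem L"
  by (induction L) (auto simp: lscale_def pconst_simps algebra_simps)

lemma lsem_lmult [simp]: "lsem (lmult L M) = lsem L * lsem M"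
proof (induction L)
  case (Cons t L)
  have "lsem (map (\<lambda>u. (frac_mult (fst t) (fst u), snd t @ snd u)) M)
    = pconst (frac_val (fst t)) * mono_poly (snd t) * lsem M"
    by (induction M) (auto simp: pconst_simps algebra_simps)
  then show ?case using Cons by (simp add: lmult_def algebra_simps)
qed (simp add: lmult_def)

lemma lsem_lvar [simp]: "lsem (lvar x) = pvar x"
  by (simp add: lvar_def pconst_simps)

text \<open>Every cofactor has a list, so a search over lists misses no certificate.\<close>

lemma lsem_surj: "\<exists>L. lsem L = p"
proof (induction p rule: poly_mapping_induct_single)
  case zero
  show ?case by (rule exI[of _ "[]"]) simp
next
  case (single m u)
  obtain xs where "m = mono_of xs" using mono_of_surj by metis
  moreover obtain q where "frac_val q = u" using frac_val_surj by blast
  ultimately show ?case by (intro exI[of _ "[(q, xs)]"]) (simp add: single_eq_mono_poly)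
next
  case (add p q)
  then show ?case using lsem_append by metis
qed

lemma computable_lmult [computable_intros]:
  assumes "computable f" "computable g"
  shows "computable (\<lambda>x. lmult (f x) (g x))"
  unfolding lmult_def by (intro computable_intros assms computable_compose[OF assms(2)])

lemma computable_lscale [computable_intros]:
  assumes "computable f" "computable g"
  shows "computable (\<lambda>x. lscale (f x) (g x))"
  unfolding lscale_def by (intro computable_intros assms computable_compose[OF assms(1)])

lemma computable_lvar [computable_intros]:
  assumes "computable f"
  shows "computable (\<lambda>x. lvar (f x))"
  unfolding lvar_def by (intro computable_intros assms)

section \<open>Evaluation and zero test for list polynomials\<close>

definition leval :: "(nat \<Rightarrow> frac) \<Rightarrow> lpoly \<Rightarrow> frac" where
  "leval F L = frac_sum (map (\<lambda>t. frac_mult (fst t) (frac_prod (map F (snd t)))) L)"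

definition lvars :: "lpoly \<Rightarrow> nat set" where
  "lvars L = (\<Union>t\<in>set L. set (snd t))"

lemma evalp_mono_poly: "evalp F (mono_poly xs) = prod_list (map F xs)"
  by (induction xs) (auto simp flip: pconst_simps(2))

text \<open>Agreement is asked only on occurring variables, because a decoded output function is
  guaranteed only on the variables of its automaton.\<close>

lemma frac_val_leval:
  assumes "\<And>x. x \<in> lvars L \<Longrightarrow> frac_val (F x) = G x"
  shows "frac_val (leval F L) = evalp G (lsem L)"
  using assms
proof (induction L)
  case (Cons t L)
  have "map (\<lambda>x. frac_val (F x)) (snd t) = map G (snd t)" using Cons.prems by (auto simp: lvars_def)
  then have "prod_list (map (\<lambda>x. frac_val (F x)) (snd t)) = prod_list (map G (snd t))" by (rule arg_cong)
  then show ?case using Cons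
    by (simp add: leval_def lvars_def evalp_mono_poly frac_val_sum frac_val_prod o_def)
qed (simp add: leval_def frac_val_sum)

lemma computable_leval [computable_intros]:
  assumes "computable (\<lambda>p. F (fst p) (snd p))" "computable f"
  shows "computable (\<lambda>x. leval (F x) (f x))"
  unfolding leval_def by (intro computable_intros assms computable_apply2[OF assms(1)])

text \<open>Filtering for \<open>x\<close> leaves copies of \<open>x\<close>, so the comparison is
  one of multiplicities; bounding \<open>x\<close> by the two lists keeps it decidable.\<close>

definition same_mono :: "nat list \<Rightarrow> nat list \<Rightarrow> bool" where
  "same_mono xs ys \<longleftrightarrow> (\<forall>x\<in>set (xs @ ys). filter (\<lambda>y. y = x) xs = filter (\<lambda>y. y = x) ys)"

lemma same_mono_iff: "same_mono xs ys \<longleftrightarrow> mono_of xs = mono_of ys"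
proof -
  have "filter (\<lambda>y. y = x) xs = replicate (count (mset xs) x) x" for x and xs :: "nat list"
    by (induction xs) auto
  then have "same_mono xs ys \<longleftrightarrow> (\<forall>x\<in>set (xs @ ys). count (mset xs) x = count (mset ys) x)"
    unfolding same_mono_def by (metis length_replicate)
  also have "\<dots> \<longleftrightarrow> (\<forall>x. count (mset xs) x = count (mset ys) x)"
    by (metis count_mset_0_iff in_set_conv_decomp set_append Un_iff)
  finally show ?thesis by (simp add: mono_of_eq_iff multiset_eq_iff)
qed

lemma decidable_same_mono [computable_intros]:
  assumes "computable f" "computable g"
  shows "decidable (\<lambda>x. same_mono (f x) (g x))"
  unfolding same_mono_def
  by (intro computable_intros assms computable_compose[OF assms(1)] computable_compose[OF assms(2)])

text \<open>Lists are not normalised: one monomial may occur repeatedly and in several orders, so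
  its coefficients are collected before the test.\<close>

definition lzero :: "lpoly \<Rightarrow> bool" where
  "lzero L \<longleftrightarrow> (\<forall>t\<in>set L. frac_is_zero (frac_sum (map fst (filter (\<lambda>u. same_mono (snd t) (snd u)) L))))"

lemma lookup_lsem:
  "Poly_Mapping.lookup (lsem L) m = frac_val (frac_sum (map fst (filter (\<lambda>u. m = mono_of (snd u)) L)))"
  by (induction L) (auto simp: frac_val_sum lookup_add lookup_single when_def simp flip: single_eq_mono_poly)

lemma lzero_iff: "lzero L \<longleftrightarrow> lsem L = 0"
proof -
  have "lzero L \<longleftrightarrow> (\<forall>t\<in>set L. Poly_Mapping.lookup (lsem L) (mono_of (snd t)) = 0)"
    by (simp add: lzero_def frac_is_zero_iff lookup_lsem same_mono_iff)
  also have "\<dots> \<longleftrightarrow> (\<forall>m. Poly_Mapping.lookup (lsem L) m = 0)"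
  proof (intro iffI allI)
    fix m assume *: "\<forall>t\<in>set L. Poly_Mapping.lookup (lsem L) (mono_of (snd t)) = 0"
    show "Poly_Mapping.lookup (lsem L) m = 0"
    proof (cases "\<exists>t\<in>set L. m = mono_of (snd t)")
      case False
      then have "filter (\<lambda>u. m = mono_of (snd u)) L = []" by (simp add: filter_empty_conv)
      then show ?thesis by (simp only: lookup_lsem) (simp add: frac_sum_def)
    qed (use * in auto)
  qed auto
  finally show ?thesis by (simp add: poly_mapping_eq_iff fun_eq_iff)
qed

lemma decidable_lzero [computable_intros]:
  assumes "computable f"
  shows "decidable (\<lambda>x. lzero (f x))"
  unfolding lzero_def by (intro computable_intros assms computable_compose[OF assms])

text \<open>\<open>K = (A, B, C)\<close> holds the coefficients of the product rule
  \<open>A x y + B (x y' + x' y) + C x' y'\<close>.\<close>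

definition lrule :: "frac \<times> frac \<times> frac \<Rightarrow> lpoly \<Rightarrow> lpoly \<Rightarrow> lpoly \<Rightarrow> lpoly \<Rightarrow> lpoly" where
  "lrule K L L' M M' = lscale (fst K) (lmult L M) @ lscale (fst (snd K)) (lmult L M' @ lmult L' M)
     @ lscale (snd (snd K)) (lmult L' M')"

definition lmono_ext :: "frac \<times> frac \<times> frac \<Rightarrow> (nat \<Rightarrow> lpoly) \<Rightarrow> nat list \<Rightarrow> lpoly" where
  "lmono_ext K D = rec_list [] (\<lambda>x ys r. if ys = [] then D x
     else lrule K (lvar x) (D x) [(frac_one, ys)] r)"

definition lext :: "frac \<times> frac \<times> frac \<Rightarrow> (nat \<Rightarrow> lpoly) \<Rightarrow> lpoly \<Rightarrow> lpoly" where
  "lext K D L = concat (map (\<lambda>t. lscale (fst t) (lmono_ext K D (snd t))) L)"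

text \<open>\<open>K\<close> is a constant rather than an argument: it depends only on the product
  rule, which is fixed before any input.\<close>

lemma computable_lrule [computable_intros]:
  assumes "computable f1" "computable f2" "computable f3" "computable f4"
  shows "computable (\<lambda>x. lrule K (f1 x) (f2 x) (f3 x) (f4 x))"
  unfolding lrule_def by (intro computable_intros assms)

lemma computable_lext [computable_intros]:
  assumes "computable (\<lambda>p. D (fst p) (snd p))" "computable f"
  shows "computable (\<lambda>x. lext K (D x) (f x))"
  unfolding lext_def lmono_ext_def
  by (intro computable_intros assms computable_apply2[OF assms(1)])

context bac_rule
begin

lemma lsem_lmono_ext:
  assumes "frac_val A = a" "frac_val B = b" "frac_val C = c"
  shows "lsem (lmono_ext (A, B, C) D xs) = mono_ext (\<lambda>x. lsem (D x)) xs"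
proof (induction xs)
  case (Cons x xs)
  then show ?case using assms
    by (cases "xs = []") (auto simp: lmono_ext_def lrule_def mono_ext_Cons rule_poly_def pconst_simps)
qed (simp add: lmono_ext_def)

lemma lsem_lext:
  assumes "frac_val A = a" "frac_val B = b" "frac_val C = c"
  shows "lsem (lext (A, B, C) D L) = rule_ext (\<lambda>x. lsem (D x)) (lsem L)"
  by (induction L)
    (auto simp: lext_def rule_ext_add rule_ext_mono lsem_lmono_ext[OF assms])

end

section \<open>Occurring variables and renaming\<close>

lemma lvars_simps [simp]:
  "lvars [] = {}" "lvars (t # L) = set (snd t) \<union> lvars L" "lvars (L @ M) = lvars L \<union> lvars M"
  "lvars (lscale q L) = lvars L" "lvars (lvar x) = {x}"
  by (auto simp: lvars_def lscale_def lvar_def)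

lemma lvars_lmult: "lvars (lmult L M) \<subseteq> lvars L \<union> lvars M"
  by (auto simp: lvars_def lmult_def)

text \<open>Confines all derivatives to finitely many variables, as the basis theorem
  requires.\<close>

lemma lvars_lext:
  assumes "\<And>x. x \<in> Z \<Longrightarrow> lvars (D x) \<subseteq> Z" "lvars L \<subseteq> Z"
  shows "lvars (lext K D L) \<subseteq> Z"
proof -
  have rule: "lvars (lrule K L L' M M') \<subseteq> Z"
    if "lvars L \<subseteq> Z" "lvars L' \<subseteq> Z" "lvars M \<subseteq> Z" "lvars M' \<subseteq> Z" for L L' M M'
    using that lvars_lmult[of L M] lvars_lmult[of L M'] lvars_lmult[of L' M] lvars_lmult[of L' M']
    by (simp add: lrule_def) blast
  have mono: "lvars (lmono_ext K D xs) \<subseteq> Z" if "set xs \<subseteq> Z" for xs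
    using that
  proof (induction xs)
    case (Cons x xs)
    then show ?case using assms(1)[of x] rule[of "lvar x" "D x" "[(frac_one, xs)]"]
      by (auto simp: lmono_ext_def split: if_splits)
  qed (simp add: lmono_ext_def)
  show ?thesis using assms(2)
  proof (induction L)
    case (Cons t L)
    then show ?case using mono[of "snd t"] by (simp add: lext_def)
  qed (simp add: lext_def)
qed

definition lrename :: "(nat \<Rightarrow> nat) \<Rightarrow> lpoly \<Rightarrow> lpoly" where
  "lrename g L = map (\<lambda>t. (fst t, map g (snd t))) L"

lemma lrename_simps:
  "lrename g (L @ M) = lrename g L @ lrename g M"
  "lrename g (lscale q L) = lscale q (lrename g L)"
  "lrename g (lmult L M) = lmult (lrename g L) (lrename g M)"
  "lrename g (lvar x) = lvar (g x)"
  by (auto simp: lrename_def lscale_def lmult_def lvar_def map_concat o_def)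

text \<open>The equation holds between the lists themselves, so it iterates along words by
  rewriting.\<close>

lemma lrename_lext:
  assumes "\<And>x. D' (g x) = lrename g (D x)"
  shows "lext K D' (lrename g L) = lrename g (lext K D L)"
proof -
  have mono: "lmono_ext K D' (map g xs) = lrename g (lmono_ext K D xs)" for xs
    by (induction xs) (auto simp: lmono_ext_def lrule_def assms lrename_simps, auto simp: lrename_def)
  show ?thesis
    by (induction L) (auto simp: lext_def lrename_simps mono, auto simp: lrename_def mono lscale_def)
qed

lemma lvars_lrename: "lvars (lrename g L) = g ` lvars L"
  by (auto simp: lvars_def lrename_def)

lemma leval_lrename:
  assumes "\<And>x. F' (g x) = F x"
  shows "leval F' (lrename g L) = leval F L"
  by (simp add: leval_def lrename_def o_def assms)

section \<open>Certificates of equivalence\<close>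

definition lrun :: "frac \<times> frac \<times> frac \<Rightarrow> (nat \<Rightarrow> nat \<Rightarrow> lpoly) \<Rightarrow> nat list \<Rightarrow> lpoly \<Rightarrow> lpoly" where
  "lrun K D w L = fold (\<lambda>a M. lext K (D a) M) w L"

lemma lrun_simps [simp]:
  "lrun K D [] L = L" "lrun K D (a # w) L = lrun K D w (lext K (D a) L)"
  "lrun K D (w @ [a]) L = lext K (D a) (lrun K D w L)"
  by (simp_all add: lrun_def)

lemma computable_lrun [computable_intros]:
  assumes "computable (\<lambda>p. D (fst p) (fst (snd p)) (snd (snd p)))" "computable w" "computable L"
  shows "computable (\<lambda>x. lrun K (D x) (w x) (L x))"
  unfolding lrun_def
  by (intro computable_intros assms computable_apply3[OF assms(1)])

lemma lvars_lrun:
  assumes "\<And>a x. a \<in> set w \<Longrightarrow> x \<in> Z \<Longrightarrow> lvars (D a x) \<subseteq> Z" "lvars L \<subseteq> Z"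
  shows "lvars (lrun K D w L) \<subseteq> Z"
  using assms
proof (induction w arbitrary: L)
  case (Cons a w)
  have "lvars (lext K (D a) L) \<subseteq> Z" using Cons.prems by (intro lvars_lext) auto
  then show ?case using Cons by simp
qed simp

lemma lrename_lrun:
  assumes "\<And>a x. D' a (g x) = lrename g (D a x)"
  shows "lrun K D' w (lrename g L) = lrename g (lrun K D w L)"
  by (induction w arbitrary: L) (auto simp: lrename_lext assms)

definition lcombination :: "(nat list \<Rightarrow> lpoly) \<Rightarrow> (lpoly \<times> nat list) list \<Rightarrow> lpoly" where
  "lcombination f qs = concat (map (\<lambda>t. lmult (fst t) (f (snd t))) qs)"

lemma lsem_lcombination_span:
  assumes "\<forall>t\<in>set qs. snd t \<in> W"
  shows "lsem (lcombination f qs) \<in> span_over UNIV ((\<lambda>w. lsem (f w)) ` W)"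
  using assms
  by (induction qs) (auto simp: lcombination_def intro: span_over_zero span_over_step)

lemma span_imp_lcombination:
  assumes "p \<in> span_over R ((\<lambda>w. lsem (f w)) ` W)"
  shows "\<exists>qs. (\<forall>t\<in>set qs. snd t \<in> W) \<and> lsem (lcombination f qs) = p"
  using assms
proof (induction rule: span_over.induct)
  case span_over_zero
  show ?case by (rule exI[of _ "[]"]) (simp add: lcombination_def)
next
  case (span_over_step r s x)
  then obtain qs w where "\<forall>t\<in>set qs. snd t \<in> W" "lsem (lcombination f qs) = x" "w \<in> W" "s = lsem (f w)"
    by auto
  moreover obtain M where "lsem M = r" using lsem_surj by blast
  ultimately show ?case by (intro exI[of _ "(M, w) # qs"]) (auto simp: lcombination_def)
qed

lemma lsem_in_poly_ring_below:
  assumes "lvars L \<subseteq> {..<n}"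
  shows "lsem L \<in> poly_ring_below n"
proof -
  note D = subring_setD[OF subring_poly_ring_below]
  have mono: "mono_poly xs \<in> poly_ring_below n" if "set xs \<subseteq> {..<n}" for xs
    using that by (induction xs) (auto intro: D pvar_in_poly_ring_below)
  show ?thesis using assms
    by (induction L) (auto intro!: D pconst_in_poly_ring_below mono)
qed

text \<open>A list \<open>W\<close> of words certifies that all derivatives of \<open>L\<close> vanish if its derivatives vanish and
  generate an ideal containing all their derivatives by one more letter; \<open>Q\<close> lists the cofactors.\<close>

definition certifies :: "frac \<times> frac \<times> frac \<Rightarrow> nat \<Rightarrow> (nat \<Rightarrow> nat \<Rightarrow> lpoly) \<Rightarrow> (nat \<Rightarrow> frac) \<Rightarrow> lpoly
    \<Rightarrow> nat list list \<Rightarrow> (lpoly \<times> nat list) list list \<Rightarrow> bool" where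
  "certifies K k D H L W Q \<longleftrightarrow> (\<exists>w\<in>set W. w = []) \<and>
     (\<forall>w\<in>set W. frac_is_zero (leval H (lrun K D w L)) \<and>
        (\<forall>a\<in>set w. a < k) \<and>
        (\<forall>a\<in>set [0..<k]. \<exists>qs\<in>set Q. (\<forall>t\<in>set qs. \<exists>v\<in>set W. snd t = v) \<and>
           lzero (lrun K D (w @ [a]) L @ lscale frac_neg_one (lcombination (\<lambda>v. lrun K D v L) qs))))"

section \<open>Soundness and completeness of certificates\<close>

context bac_rule
begin

text \<open>Write \<open>r\<close> as a constant plus \<open>r0\<close> in \<open>Q0\<close>.
  Linearity treats the constant; the product rule applies to \<open>r0 * s\<close>, and each of its
  terms contains \<open>s\<close> or the derivative of \<open>s\<close>.\<close>

lemma rule_ext_mult_ideal: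
  assumes "s \<in> Q0"
  obtains x y where "rule_ext D (r * s) = x * s + y * rule_ext D s"
proof -
  define u where "u = evalp (\<lambda>_. 0) r"
  define r0 where "r0 = r - pconst u"
  have r: "r = pconst u + r0" by (simp add: r0_def)
  have "evalp (\<lambda>_. 0) (pconst u + r0) = u" using r u_def by simp
  then have "r0 \<in> Q0" by (simp add: Q0_iff_evalp)
  then have "rule_ext D (r * s) = pconst u * rule_ext D s + rule_poly r0 (rule_ext D r0) s (rule_ext D s)"
    using assms by (simp add: r distrib_right rule_ext_add rule_ext_scale rule_ext_mult)
  also have "\<dots> = (pconst a * r0 + pconst b * rule_ext D r0) * s
      + (pconst u + pconst b * r0 + pconst c * rule_ext D r0) * rule_ext D s"
    by (simp add: rule_poly_def algebra_simps)
  finally show ?thesis by (rule that)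
qed

text \<open>The ideal \<open>I\<close> generated by the listed derivatives is closed under all
  derivatives and contained in the kernel of evaluation; containing \<open>L\<close>, it contains
  every derivative of \<open>L\<close>.\<close>

lemma certifies_imp_vanish:
  assumes K: "frac_val A = a" "frac_val B = b" "frac_val C = c"
    and D: "\<And>i x. i < k \<Longrightarrow> lsem (D i x) \<in> Q0" and L: "lsem L \<in> Q0"
    and cert: "certifies (A, B, C) k D H L W Q" and w: "\<forall>i\<in>set w. i < k"
  shows "frac_is_zero (leval H (lrun (A, B, C) D w L))"
proof -
  let ?K = "(A, B, C)"
  let ?f = "\<lambda>w. lsem (lrun ?K D w L)"
  let ?E = "\<lambda>i. rule_ext (\<lambda>x. lsem (D i x))"
  let ?H = "\<lambda>x. frac_val (H x)"
  define I where "I = span_over UNIV (?f ` set W)"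
  have step: "?f (w @ [i]) = ?E i (?f w)" for w i by (simp add: lsem_lext[OF K])
  have Q0: "?f w \<in> Q0" if "\<forall>i\<in>set w. i < k" for w
    using that
  proof (induction w rule: rev_induct)
    case (snoc i w)
    then show ?case unfolding step using D by (intro rule_ext_Q0) auto
  qed (simp add: L)
  have eval: "frac_is_zero (leval H M) \<longleftrightarrow> evalp ?H (lsem M) = 0" for M
    by (simp add: frac_is_zero_iff frac_val_leval)
  have gen: "?f w \<in> Q0 \<and> evalp ?H (?f w) = 0 \<and> (\<forall>i<k. ?E i (?f w) \<in> I)" if "w \<in> set W" for w
  proof -
    have "?E i (?f w) \<in> I" if i: "i < k" for i
    proof -
      obtain qs where "\<forall>t\<in>set qs. snd t \<in> set W"
        "lzero (lrun ?K D (w @ [i]) L @ lscale frac_neg_one (lcombination (\<lambda>v. lrun ?K D v L) qs))"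
        using cert \<open>w \<in> set W\<close> i unfolding certifies_def by fastforce
      then have "?f (w @ [i]) = lsem (lcombination (\<lambda>v. lrun ?K D v L) qs)"
        "lsem (lcombination (\<lambda>v. lrun ?K D v L) qs) \<in> I"
        unfolding lzero_iff I_def using lsem_lcombination_span[of qs "set W"]
        by (auto simp: pconst_simps)
      then show ?thesis unfolding step by simp
    qed
    then show ?thesis using cert that Q0 unfolding certifies_def eval by auto
  qed
  \<comment> \<open>Membership in \<open>Q0\<close> follows from that of the generators, although
    cofactors are arbitrary; this keeps \<open>I\<close> inside the domain of the extension.\<close>
  have I: "p \<in> Q0 \<and> evalp ?H p = 0 \<and> (\<forall>i<k. ?E i p \<in> I)" if "p \<in> I" for p
    using that unfolding I_def
  proof (induction rule: span_over.induct)
    case span_over_zero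
    then show ?case by (auto simp: Q0_closed intro: span_over.intros)
  next
    case (span_over_step r s x)
    have s: "s \<in> Q0" "evalp ?H s = 0" "\<And>i. i < k \<Longrightarrow> ?E i s \<in> I" using gen span_over_step(2) by auto
    have sI: "s \<in> I" unfolding I_def using span_over_step(2) by (rule span_over_base[OF subring_UNIV])
    have "?E i (r * s) \<in> I" if "i < k" for i
    proof -
      obtain x y where "?E i (r * s) = x * s + y * ?E i s" using rule_ext_mult_ideal[OF s(1)] .
      then show ?thesis using sI s(3)[OF that]
        unfolding I_def by (auto intro!: span_over_add span_over_mult[OF subring_UNIV])
    qed
    then show ?case using s span_over_step
      by (auto simp: Q0_closed rule_ext_add I_def intro: span_over_add)
  qed
  have "?f w \<in> I" using w
  proof (induction w rule: rev_induct)
    case Nil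
    have "[] \<in> set W" using cert by (auto simp: certifies_def)
    then have "?f [] \<in> ?f ` set W" by (rule imageI)
    then show ?case unfolding I_def by (rule span_over_base[OF subring_UNIV])
  next
    case (snoc i w)
    then show ?case unfolding step using I by auto
  qed
  then show ?thesis using I eval by blast
qed

lemma vanish_imp_certifies:
  assumes K: "frac_val A = a" "frac_val B = b" "frac_val C = c"
    and Z: "finite Z" "\<And>i x. i < k \<Longrightarrow> x \<in> Z \<Longrightarrow> lvars (D i x) \<subseteq> Z" "lvars L \<subseteq> Z"
    and vanish: "\<And>w. \<forall>i\<in>set w. i < k \<Longrightarrow> frac_is_zero (leval H (lrun (A, B, C) D w L))"
  shows "\<exists>W Q. certifies (A, B, C) k D H L W Q"
proof -
  let ?K = "(A, B, C)"
  let ?f = "\<lambda>w. lsem (lrun ?K D w L)"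
  let ?words = "{w. \<forall>i\<in>set w. i < k}"
  obtain n where n: "Z \<subseteq> {..<n}" using Z(1) finite_nat_iff_bounded by blast
  have "?f w \<in> poly_ring_below n" if "w \<in> ?words" for w
    using that n by (intro lsem_in_poly_ring_below order.trans[OF lvars_lrun n] Z) auto
  then have "?f ` ?words \<subseteq> poly_ring_below n" by blast
  from noetherian_poly_ring_below[unfolded noetherian_set_def, rule_format, OF this]
  obtain S0 where S0: "S0 \<subseteq> ?f ` ?words" "finite S0" "?f ` ?words \<subseteq> span_over (poly_ring_below n) S0"
    by blast
  obtain W0 where W0: "W0 \<subseteq> ?words" "finite W0" "S0 = ?f ` W0"
    using finite_subset_image[OF S0(2,1)] by auto
  obtain ws where ws: "set ws = W0" using finite_list[OF W0(2)] by blast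
  \<comment> \<open>The basis may avoid \<open>L\<close> itself, but soundness starts its induction
    at the empty word.\<close>
  define W where "W = [] # ws"
  have W: "set W \<subseteq> ?words" using W0 ws by (auto simp: W_def)
  have "\<exists>qs. (\<forall>t\<in>set qs. snd t \<in> set W) \<and> lsem (lcombination (\<lambda>v. lrun ?K D v L) qs) = ?f (w @ [i])"
    if "w \<in> set W" "i < k" for w i
  proof (rule span_imp_lcombination)
    have "w @ [i] \<in> ?words" using that W by auto
    then have "?f (w @ [i]) \<in> span_over (poly_ring_below n) (?f ` W0)" using S0(3) W0(3) by blast
    then show "?f (w @ [i]) \<in> span_over (poly_ring_below n) (?f ` set W)"
      by (rule span_over_mono[rotated 2]) (auto simp: W_def ws)
  qed
  then obtain q where q: "\<And>w i. w \<in> set W \<Longrightarrow> i < k \<Longrightarrow> (\<forall>t\<in>set (q w i). snd t \<in> set W) \<and>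
      lsem (lcombination (\<lambda>v. lrun ?K D v L) (q w i)) = ?f (w @ [i])" by metis
  define Q where "Q = map (\<lambda>t. q (fst t) (snd t)) (List.product W [0..<k])"
  have "certifies ?K k D H L W Q" unfolding certifies_def
  proof (intro conjI ballI)
    show "\<exists>w\<in>set W. w = []" by (simp add: W_def)
  next
    fix w assume "w \<in> set W"
    then show "frac_is_zero (leval H (lrun ?K D w L))" using W vanish by auto
  next
    fix w i assume "w \<in> set W" "i \<in> set w"
    then show "i < k" using W by auto
  next
    fix w i assume wi: "w \<in> set W" "i \<in> set [0..<k]"
    show "\<exists>qs\<in>set Q. (\<forall>t\<in>set qs. \<exists>v\<in>set W. snd t = v) \<and>
      lzero (lrun ?K D (w @ [i]) L @ lscale frac_neg_one (lcombination (\<lambda>v. lrun ?K D v L) qs))"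
    proof (intro bexI conjI)
      show "q w i \<in> set Q" using wi unfolding Q_def by force
      show "\<forall>t\<in>set (q w i). \<exists>v\<in>set W. snd t = v" using q wi by auto
      show "lzero (lrun ?K D (w @ [i]) L @ lscale frac_neg_one (lcombination (\<lambda>v. lrun ?K D v L) (q w i)))"
        using q[of w i] wi by (simp add: lzero_iff pconst_simps)
    qed
  qed
  then show ?thesis by blast
qed

section \<open>Runs on lists and the semantics of automata\<close>

lemma lsem_lrun:
  assumes K: "frac_val A = a" "frac_val B = b" "frac_val C = c"
  shows "lsem (lrun (A, B, C) D w L) = fold (\<lambda>i. rule_ext (\<lambda>x. lsem (D i x))) w (lsem L)"
  by (induction w arbitrary: L) (auto simp: lsem_lext[OF K])

lemma lsem_lrun_diff:
  assumes K: "frac_val A = a" "frac_val B = b" "frac_val C = c"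
  shows "lsem (lrun (A, B, C) D w (L @ lscale frac_neg_one M)) =
    lsem (lrun (A, B, C) D w L) - lsem (lrun (A, B, C) D w M)"
proof -
  have "fold (\<lambda>i. rule_ext (\<lambda>x. lsem (D i x))) w (p - q) = fold (\<lambda>i. rule_ext (\<lambda>x. lsem (D i x))) w p
    - fold (\<lambda>i. rule_ext (\<lambda>x. lsem (D i x))) w q" for p q
    by (induction w arbitrary: p q) (auto simp: rule_ext_diff)
  from this[of "lsem L" "lsem M"] show ?thesis
    by (simp add: lsem_lrun[OF K] pconst_simps)
qed

lemma asem_eq_lrun:
  assumes K: "frac_val A = a" "frac_val B = b" "frac_val C = c"
    and X: "valid_aut k X \<Delta>" "\<And>i x. i < k \<Longrightarrow> lsem (D i x) = (if x \<in> X then \<Delta> i x else 0)"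
    and w: "\<forall>i\<in>set w. i < k" and L: "lsem L \<in> Q0"
  shows "asem P X F \<Delta> w (lsem L) = evalp F (lsem (lrun (A, B, C) D w L))"
  using w L
proof (induction w arbitrary: L)
  case (Cons i w)
  let ?D = "\<lambda>x. if x \<in> X then \<Delta> i x else 0"
  have i: "i < k" using Cons.prems by simp
  have Q0: "?D x \<in> Q0" for x
    using X(1) i by (auto simp: valid_aut_def Q0_over_def Q0_closed)
  have "lsem (lext (A, B, C) (D i) L) = rule_ext ?D (lsem L)"
    by (simp add: lsem_lext[OF K] X(2)[OF i])
  also have "\<dots> = ext P ?D (lsem L)" using ext_eq_rule_ext[of ?D] Q0 Cons.prems(2) by simp
  finally have eq: "lsem (lext (A, B, C) (D i) L) = ext P ?D (lsem L)" .
  moreover have "lsem (lext (A, B, C) (D i) L) \<in> Q0"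
    unfolding lsem_lext[OF K] X(2)[OF i] using rule_ext_Q0[of ?D] Q0 by blast
  ultimately show ?case using Cons.IH[of "lext (A, B, C) (D i) L"] Cons.prems(1) by simp
qed simp

end

section \<open>Decoding the input\<close>

text \<open>Bit \<open>i\<close> set forces \<open>2 ^ i \<le> n\<close>; enumerating the numbers
  below \<open>n\<close> therefore finds every element.\<close>

lemma in_set_decode_less: "i \<in> set_decode n \<Longrightarrow> i < n"
proof -
  assume "i \<in> set_decode n"
  then have "n div 2 ^ i \<noteq> 0" by (auto simp: set_decode_def intro: ccontr)
  then have "2 ^ i \<le> n" by (simp add: div_eq_0_iff)
  then show "i < n" using less_exp[of i] by linarith
qed

definition set_list :: "nat \<Rightarrow> nat list" where
  "set_list n = filter (\<lambda>i. i \<in> set_decode n) [0..<n]"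

lemma set_set_list: "finite A \<Longrightarrow> set (set_list (set_encode A)) = A"
  using in_set_decode_less[of _ "set_encode A"] by (auto simp: set_list_def)

lemma distinct_set_list: "distinct (set_list n)"
  by (simp add: set_list_def)

lemma sum_list_set_list:
  assumes "finite A"
  shows "sum_list (map f (set_list (set_encode A))) = sum f A"
  by (simp add: sum_list_distinct_conv_sum_set distinct_set_list set_set_list assms)

lemma computable_set_list [computable_intros]:
  assumes "computable f"
  shows "computable (\<lambda>x. set_list (f x))"
  unfolding set_list_def by (intro computable_intros assms computable_compose[OF assms])

text \<open>Looks up a function value in an encoded graph, \<open>g i\<close> being the code of the
  entry with value \<open>i\<close>. The default 0 decodes to the zero polynomial, matching the
  extension of transitions by 0 outside the variable set.\<close>

definition find_code :: "(nat \<Rightarrow> nat) \<Rightarrow> nat \<Rightarrow> nat" where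
  "find_code g n = fold (\<lambda>i y. if g i \<in> set_decode n then i else y) [0..<n] 0"

lemma find_code_unique:
  assumes "\<And>i. g i \<in> set_decode n \<longleftrightarrow> i = v" "\<And>i. i \<le> g i"
  shows "find_code g n = v"
proof -
  have "v < n" using in_set_decode_less[of "g v" n] assms(1)[of v] assms(2)[of v] by simp
  moreover have "fold (\<lambda>i y. if i = v then i else y) xs y = (if v \<in> set xs then v else y)" for xs y
    by (induction xs arbitrary: y) auto
  ultimately show ?thesis by (simp add: find_code_def assms(1))
qed

lemma find_code_none:
  assumes "\<And>i. g i \<notin> set_decode n"
  shows "find_code g n = 0"
proof -
  have "fold (\<lambda>i y. y) xs y = y" for xs :: "nat list" and y :: nat by (induction xs) auto
  then show ?thesis using assms by (simp add: find_code_def)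
qed

lemma computable_find_code [computable_intros]:
  assumes "computable (\<lambda>p. g (fst p) (snd p))" "computable n"
  shows "computable (\<lambda>x. find_code (g x) (n x))"
  unfolding find_code_def
  by (intro computable_intros assms computable_apply2[OF assms(1)] computable_compose[OF assms(2)])

lemma computable_prod_encode [computable_intros]:
  assumes "computable f" "computable g"
  shows "computable (\<lambda>x. prod_encode (f x, g x))"
  using computable_Pair[OF assms] by (rule computable_enc_cong) (simp add: enc_prod_def)

lemma computable_hd [computable_intros]:
  assumes "computable f"
  shows "computable (\<lambda>x. hd (f x))"
proof -
  \<comment> \<open>\<open>hd []\<close> is unspecified but fixed, hence a constant.\<close>
  have "computable (\<lambda>x. case_list (hd []) (\<lambda>a r. a) (f x))" by (intro computable_intros assms)
  then show ?thesis by (rule computable_enc_cong) (simp split: list.split)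
qed

lemma computable_tl [computable_intros]:
  assumes "computable f"
  shows "computable (\<lambda>x. tl (f x))"
  unfolding tl_def by (intro computable_intros assms)

text \<open>\<open>int_encode\<close> maps \<open>i \<ge> 0\<close> to \<open>2 * i\<close> and
  \<open>i < 0\<close> to \<open>2 * (- i - 1) + 1\<close>, hence the \<open>Suc\<close> for odd
  codes. A denominator \<open>j\<close> is positive with code \<open>2 * j\<close>, and its
  predecessor is stored.\<close>

definition dec_frac :: "nat \<Rightarrow> frac" where
  "dec_frac n = (let i = fst (prod_decode n) in
     (if odd i then (0, Suc (i div 2)) else (i div 2, 0), snd (prod_decode n) div 2 - 1))"

lemma frac_val_dec_frac: "frac_val (dec_frac (rat_code r)) = r"
proof -
  obtain i j where ij: "quotient_of r = (i, j)" by fastforce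
  have j: "j > 0" using quotient_of_denom_pos[OF ij] .
  have "Suc (int_encode j div 2 - 1) = nat j" using j by (simp add: int_encode_def sum_encode_def)
  then have d: "(of_nat (Suc (int_encode j div 2 - 1)) :: rat) = of_int j" using j by (simp del: of_nat_Suc)
  have "frac_val (dec_frac (rat_code r)) = of_int i / of_int j"
  proof (cases "i \<ge> 0")
    case True
    then show ?thesis using d
      by (simp add: dec_frac_def rat_code_def ij frac_val_def int_encode_def sum_encode_def del: of_nat_Suc)
  next
    case False
    then have "(of_nat (Suc (nat (- i - 1))) :: rat) = - of_int i" by simp
    then show ?thesis using False d
      by (simp add: dec_frac_def rat_code_def ij frac_val_def int_encode_def sum_encode_def del: of_nat_Suc)
  qed
  then show ?thesis using quotient_of_div[OF ij] by simp
qed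

lemma computable_dec_frac [computable_intros]:
  "computable f \<Longrightarrow> computable (\<lambda>x. dec_frac (f x))"
  unfolding dec_frac_def Let_def by (intro computable_intros)

definition dec_mono :: "nat \<Rightarrow> nat list" where
  "dec_mono n = concat (map (\<lambda>i. replicate (snd (prod_decode i)) (fst (prod_decode i))) (set_list n))"

lemma mono_of_concat: "mono_of (concat xss) = sum_list (map mono_of xss)"
  by (induction xss) auto

lemma mono_of_dec_mono: "mono_of (dec_mono (mono_code m)) = m"
proof -
  have "mono_of (dec_mono (mono_code m)) =
      (\<Sum>i\<in>(\<lambda>x. prod_encode (x, Poly_Mapping.lookup m x)) ` Poly_Mapping.keys m.
        Poly_Mapping.single (fst (prod_decode i)) (snd (prod_decode i)))"
    unfolding dec_mono_def mono_of_concat map_map o_def mono_of_replicate mono_code_def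
    by (rule sum_list_set_list) simp
  also have "\<dots> = (\<Sum>x\<in>Poly_Mapping.keys m. Poly_Mapping.single x (Poly_Mapping.lookup m x))"
    by (subst sum.reindex) (auto intro: inj_onI)
  finally show ?thesis using poly_mapping_sum_single[of m] by simp
qed

lemma set_dec_mono: "set (dec_mono (mono_code m)) = Poly_Mapping.keys m"
  using lookup_mono_of[of "dec_mono (mono_code m)"]
  by (auto simp: mono_of_dec_mono in_keys_iff)

lemma computable_dec_mono [computable_intros]:
  "computable f \<Longrightarrow> computable (\<lambda>x. dec_mono (f x))"
  unfolding dec_mono_def by (intro computable_intros)

definition dec_poly :: "nat \<Rightarrow> lpoly" where
  "dec_poly n = map (\<lambda>i. (dec_frac (snd (prod_decode i)), dec_mono (fst (prod_decode i)))) (set_list n)"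

lemma lsem_dec_poly: "lsem (dec_poly (poly_code p)) = p"
proof -
  let ?g = "\<lambda>m. prod_encode (mono_code m, rat_code (Poly_Mapping.lookup p m))"
  have inj: "inj_on ?g (Poly_Mapping.keys p)"
    by (rule inj_onI) (metis Pair_inject mono_of_dec_mono prod_encode_eq)
  have "lsem (dec_poly (poly_code p)) = (\<Sum>i\<in>?g ` Poly_Mapping.keys p.
      pconst (frac_val (dec_frac (snd (prod_decode i)))) * mono_poly (dec_mono (fst (prod_decode i))))"
    unfolding lsem_def dec_poly_def map_map o_def fst_conv snd_conv poly_code_def
    by (rule sum_list_set_list) simp
  also have "\<dots> = (\<Sum>m\<in>Poly_Mapping.keys p. Poly_Mapping.single m (Poly_Mapping.lookup p m))"
    by (subst sum.reindex[OF inj])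
      (simp add: frac_val_dec_frac mono_of_dec_mono flip: single_eq_mono_poly)
  finally show ?thesis using poly_mapping_sum_single[of p] by simp
qed

lemma lvars_dec_poly: "lvars (dec_poly (poly_code p)) = pvars p"
  by (simp add: lvars_def dec_poly_def poly_code_def set_set_list set_dec_mono pvars_def)

lemma dec_poly_0 [simp]: "dec_poly 0 = []"
  by (simp add: dec_poly_def set_list_def)

lemma computable_dec_poly [computable_intros]:
  "computable f \<Longrightarrow> computable (\<lambda>x. dec_poly (f x))"
  unfolding dec_poly_def by (intro computable_intros)

definition dec_out :: "nat \<Rightarrow> nat \<Rightarrow> frac" where
  "dec_out n x = dec_frac (find_code (\<lambda>i. prod_encode (x, i)) (hd (tl (list_decode n))))"

definition dec_trans :: "nat \<Rightarrow> nat \<Rightarrow> nat \<Rightarrow> lpoly" where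
  "dec_trans n a x = dec_poly (find_code (\<lambda>i. prod_encode (a, prod_encode (x, i))) (hd (tl (tl (list_decode n)))))"

lemma computable_dec_out [computable_intros]:
  assumes "computable f" "computable g"
  shows "computable (\<lambda>x. dec_out (f x) (g x))"
  unfolding dec_out_def by (intro computable_intros assms computable_compose[OF assms(2)])

lemma computable_dec_trans [computable_intros]:
  assumes "computable f" "computable g" "computable h"
  shows "computable (\<lambda>x. dec_trans (f x) (g x) (h x))"
  unfolding dec_trans_def
  by (intro computable_intros assms computable_compose[OF assms(2)] computable_compose[OF assms(3)])

lemma dec_out_aut_code:
  assumes "finite X" "x \<in> X"
  shows "frac_val (dec_out (aut_code k X F \<Delta>) x) = F x"
proof -
  let ?n = "set_encode ((\<lambda>x. prod_encode (x, rat_code (F x))) ` X)"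
  have "find_code (\<lambda>i. prod_encode (x, i)) ?n = rat_code (F x)"
    using assms by (intro find_code_unique) (auto intro: le_prod_encode_2)
  then show ?thesis by (simp add: dec_out_def aut_code_def frac_val_dec_frac)
qed

lemma dec_trans_aut_code:
  assumes "finite X" "a < k"
  shows "dec_trans (aut_code k X F \<Delta>) a x = (if x \<in> X then dec_poly (poly_code (\<Delta> a x)) else [])"
proof -
  let ?n = "set_encode ((\<lambda>(a, x). prod_encode (a, prod_encode (x, poly_code (\<Delta> a x)))) ` ({..<k} \<times> X))"
  let ?g = "\<lambda>i. prod_encode (a, prod_encode (x, i))"
  have dec: "?g i \<in> set_decode ?n \<longleftrightarrow> x \<in> X \<and> i = poly_code (\<Delta> a x)" for i
    using assms by (auto simp: image_iff)
  have "find_code ?g ?n = (if x \<in> X then poly_code (\<Delta> a x) else 0)"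
  proof (cases "x \<in> X")
    case True
    have "i \<le> ?g i" for i using le_prod_encode_2 order.trans by blast
    then show ?thesis using True dec by (simp add: find_code_unique)
  next
    case False
    then show ?thesis using dec by (simp add: find_code_none)
  qed
  then show ?thesis by (simp add: dec_trans_def aut_code_def)
qed

lemma lsem_dec_trans:
  "finite X \<Longrightarrow> a < k \<Longrightarrow> lsem (dec_trans (aut_code k X F \<Delta>) a x) = (if x \<in> X then \<Delta> a x else 0)"
  by (simp add: dec_trans_aut_code lsem_dec_poly)

lemma lvars_dec_trans:
  "valid_aut k X \<Delta> \<Longrightarrow> a < k \<Longrightarrow> lvars (dec_trans (aut_code k X F \<Delta>) a x) \<subseteq> X"
  by (auto simp: dec_trans_aut_code lvars_dec_poly valid_aut_def Q0_over_def)

text \<open>Renaming variables leaves the value at the origin unchanged.\<close>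

lemma lsem_lrename_Q0: "lsem (lrename g L) \<in> Q0 \<longleftrightarrow> lsem L \<in> Q0"
proof -
  have "evalp (\<lambda>_. 0) (lsem M) = frac_val (leval (\<lambda>_. frac_zero) M)" for M
    by (simp add: frac_val_leval)
  then show ?thesis by (simp add: Q0_iff_evalp leval_lrename[of "\<lambda>_. frac_zero" g "\<lambda>_. frac_zero"])
qed

text \<open>The disjoint union of the two automata: even variables for the first, odd ones for the second.\<close>

definition in_size :: "nat \<Rightarrow> nat" where "in_size n = hd (list_decode n)"
definition in_aut1 :: "nat \<Rightarrow> nat" where "in_aut1 n = hd (tl (list_decode n))"
definition in_var1 :: "nat \<Rightarrow> nat" where "in_var1 n = hd (tl (tl (list_decode n)))"
definition in_aut2 :: "nat \<Rightarrow> nat" where "in_aut2 n = hd (tl (tl (tl (list_decode n))))"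
definition in_var2 :: "nat \<Rightarrow> nat" where "in_var2 n = hd (tl (tl (tl (tl (list_decode n)))))"

definition union_trans :: "nat \<Rightarrow> nat \<Rightarrow> nat \<Rightarrow> lpoly" where
  "union_trans n a z = (if odd z then lrename (\<lambda>x. Suc (2 * x)) (dec_trans (in_aut2 n) a (z div 2))
     else lrename (\<lambda>x. 2 * x) (dec_trans (in_aut1 n) a (z div 2)))"

definition union_out :: "nat \<Rightarrow> nat \<Rightarrow> frac" where
  "union_out n z = (if odd z then dec_out (in_aut2 n) (z div 2) else dec_out (in_aut1 n) (z div 2))"

definition union_start :: "nat \<Rightarrow> lpoly" where
  "union_start n = lvar (2 * in_var1 n) @ lscale frac_neg_one (lvar (Suc (2 * in_var2 n)))"

lemma computable_in [computable_intros]: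
  assumes "computable f"
  shows "computable (\<lambda>x. in_size (f x))" "computable (\<lambda>x. in_aut1 (f x))" "computable (\<lambda>x. in_var1 (f x))"
    "computable (\<lambda>x. in_aut2 (f x))" "computable (\<lambda>x. in_var2 (f x))"
  unfolding in_size_def in_aut1_def in_var1_def in_aut2_def in_var2_def
  by (intro computable_intros assms)+

lemma computable_union_trans [computable_intros]:
  assumes "computable f" "computable g" "computable h"
  shows "computable (\<lambda>x. union_trans (f x) (g x) (h x))"
  unfolding union_trans_def lrename_def by (intro computable_intros assms)

lemma computable_union_out [computable_intros]:
  assumes "computable f" "computable g"
  shows "computable (\<lambda>x. union_out (f x) (g x))"
  unfolding union_out_def by (intro computable_intros assms)

lemma computable_union_start [computable_intros]:
  assumes "computable f"
  shows "computable (\<lambda>x. union_start (f x))"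
  unfolding union_start_def by (intro computable_intros assms)

section \<open>The search for a refutation or a confirmation\<close>

definition refutes :: "frac \<times> frac \<times> frac \<Rightarrow> nat \<Rightarrow> nat list \<Rightarrow> bool" where
  "refutes K n w \<longleftrightarrow> (\<forall>a\<in>set w. a < in_size n) \<and>
     \<not> frac_is_zero (leval (union_out n) (lrun K (union_trans n) w (union_start n)))"

definition confirms :: "frac \<times> frac \<times> frac \<Rightarrow> nat \<Rightarrow> nat list list \<times> (lpoly \<times> nat list) list list \<Rightarrow> bool" where
  "confirms K n C \<longleftrightarrow> certifies K (in_size n) (union_trans n) (union_out n) (union_start n) (fst C) (snd C)"

lemma decidable_refutes [computable_intros]:
  assumes "computable f" "computable g"
  shows "decidable (\<lambda>x. refutes K (f x) (g x))"
  unfolding refutes_def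
  by (intro computable_intros assms computable_compose[OF assms(1)])

text \<open>Every quantifier in \<open>certifies\<close> ranges over list entries, even those that
  merely express membership, so the closure rules apply.\<close>

lemma decidable_confirms [computable_intros]:
  assumes "computable f" "computable g"
  shows "decidable (\<lambda>x. confirms K (f x) (g x))"
  unfolding confirms_def certifies_def lcombination_def
  by (intro computable_intros assms computable_compose[OF assms(1)] computable_compose[OF assms(2)])

text \<open>One search runs over pairs of a word and a certificate and stops when either component
  is valid. The hypothesis, stated for each \<open>n\<close>, gives termination and makes the answer
  independent of the pair found, since the two kinds of witness exclude each other.\<close>

lemma ex_decision_procedure:
  "\<exists>r. \<forall>n. ((\<exists>w. refutes K n w) \<longleftrightarrow> \<not> (\<exists>C. confirms K n C)) \<longrightarrow>
     reval r [n] (if \<exists>w. refutes K n w then 0 else 1)"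
proof -
  let ?Q = "\<lambda>n (s :: nat list \<times> nat list list \<times> (lpoly \<times> nat list) list list).
    refutes K n (fst s) \<or> confirms K n (snd s)"
  let ?g = "\<lambda>n (s :: nat list \<times> nat list list \<times> (lpoly \<times> nat list) list list).
    if refutes K n (fst s) then 0 else 1 :: nat"
  have "\<exists>r. \<forall>n. (\<exists>s. ?Q n s) \<longrightarrow> (\<exists>s. ?Q n s \<and> reval r [enc n] (enc (?g n s)))"
    by (rule computable_search) (intro computable_intros)+
  then obtain r where r: "\<forall>n. (\<exists>s. ?Q n s) \<longrightarrow> (\<exists>s. ?Q n s \<and> reval r [enc n] (enc (?g n s)))" by blast
  have "reval r [n] (if \<exists>w. refutes K n w then 0 else 1)"
    if excl: "(\<exists>w. refutes K n w) \<longleftrightarrow> \<not> (\<exists>C. confirms K n C)" for n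
  proof -
    have "\<exists>s. ?Q n s" using excl by (metis fst_conv snd_conv)
    then obtain s where s: "?Q n s" "reval r [enc n] (enc (?g n s))" using r by blast
    have "refutes K n (fst s) \<longleftrightarrow> (\<exists>w. refutes K n w)" using s(1) excl by blast
    then have "?g n s = (if \<exists>w. refutes K n w then 0 else 1)" by simp
    then show ?thesis using s(2) by (simp only: enc_nat_def)
  qed
  then show ?thesis by blast
qed

context bac_rule
begin

text \<open>The renaming \<open>g\<close> is a parameter so that the same argument serves both
  halves of the disjoint union.\<close>

lemma asem_eq_renamed_lrun:
  assumes K: "frac_val A = a" "frac_val B = b" "frac_val C = c"
    and valid: "valid_aut k X \<Delta>" "x1 \<in> X"
    and out: "\<And>x. H (g x) = dec_out (aut_code k X F \<Delta>) x"
    and trans: "\<And>i x. D i (g x) = lrename g (dec_trans (aut_code k X F \<Delta>) i x)"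
    and w: "\<forall>i\<in>set w. i < k"
  shows "evalp (\<lambda>z. frac_val (H z)) (lsem (lrun (A, B, C) D w (lvar (g x1)))) = asem P X F \<Delta> w (pvar x1)"
proof -
  let ?K = "(A, B, C)" and ?D = "dec_trans (aut_code k X F \<Delta>)" and ?H = "dec_out (aut_code k X F \<Delta>)"
  have fin: "finite X" using valid by (simp add: valid_aut_def)
  have "evalp (\<lambda>z. frac_val (H z)) (lsem (lrun ?K D w (lvar (g x1)))) =
      frac_val (leval H (lrun ?K D w (lrename g (lvar x1))))"
    by (subst frac_val_leval[where G = "\<lambda>z. frac_val (H z)"]) (simp_all add: lrename_simps)
  also have "\<dots> = frac_val (leval ?H (lrun ?K ?D w (lvar x1)))"
    using lrename_lrun[where D' = D and g = g and D = ?D, OF trans]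
      leval_lrename[where F' = H and g = g and F = ?H, OF out] by simp
  also have "\<dots> = evalp F (lsem (lrun ?K ?D w (lvar x1)))"
  proof (rule frac_val_leval)
    have "lvars (lrun ?K ?D w (lvar x1)) \<subseteq> X"
      using w valid lvars_dec_trans by (intro lvars_lrun) auto
    then show "frac_val (?H x) = F x" if "x \<in> lvars (lrun ?K ?D w (lvar x1))" for x
      using that fin dec_out_aut_code by blast
  qed
  also have "\<dots> = asem P X F \<Delta> w (lsem (lvar x1))"
    using w valid fin by (intro asem_eq_lrun[OF K, symmetric]) (auto simp: lsem_dec_trans Q0_closed)
  finally show ?thesis by simp
qed

lemma input_code_correct:
  fixes k X F \<Delta> x1 Y G \<Gamma> y1
  defines "n \<equiv> input_code k X F \<Delta> x1 Y G \<Gamma> y1"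
  assumes K: "frac_val A = a" "frac_val B = b" "frac_val C = c"
    and valid: "valid_aut k X \<Delta>" "x1 \<in> X" "valid_aut k Y \<Gamma>" "y1 \<in> Y"
  shows "(\<exists>w. refutes (A, B, C) n w) \<longleftrightarrow>
      \<not> (\<forall>w. set w \<subseteq> {..<k} \<longrightarrow> asem P X F \<Delta> w (pvar x1) = asem P Y G \<Gamma> w (pvar y1))"
    and "(\<exists>w. refutes (A, B, C) n w) \<longleftrightarrow> \<not> (\<exists>S. confirms (A, B, C) n S)"
proof -
  let ?K = "(A, B, C)"
  let ?a1 = "aut_code k X F \<Delta>" and ?a2 = "aut_code k Y G \<Gamma>"
  let ?e = "\<lambda>x. 2 * x :: nat" and ?o = "\<lambda>x. Suc (2 * x)"
  have fin: "finite X" "finite Y" using valid by (auto simp: valid_aut_def)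
  have n: "in_size n = k" "in_aut1 n = ?a1" "in_var1 n = x1" "in_aut2 n = ?a2" "in_var2 n = y1"
    by (simp_all add: n_def input_code_def in_size_def in_aut1_def in_var1_def in_aut2_def in_var2_def)
  have out: "union_out n (?e x) = dec_out ?a1 x" "union_out n (?o x) = dec_out ?a2 x" for x
    by (simp_all add: union_out_def n)
  have trans: "union_trans n i (?e x) = lrename ?e (dec_trans ?a1 i x)"
    "union_trans n i (?o x) = lrename ?o (dec_trans ?a2 i x)" for i x
    by (simp_all add: union_trans_def n)
  \<comment> \<open>Derivatives are linear, so the run from the difference of the two start
    variables splits into one run in each automaton.\<close>
  have leval: "frac_val (leval (union_out n) (lrun ?K (union_trans n) w (union_start n))) =
      asem P X F \<Delta> w (pvar x1) - asem P Y G \<Gamma> w (pvar y1)" if w: "\<forall>i\<in>set w. i < k" for w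
  proof -
    let ?H = "\<lambda>x. frac_val (union_out n x)"
    have 1: "evalp ?H (lsem (lrun ?K (union_trans n) w (lvar (?e x1)))) = asem P X F \<Delta> w (pvar x1)"
      by (rule asem_eq_renamed_lrun[OF K valid(1,2) out(1) trans(1) w])
    have 2: "evalp ?H (lsem (lrun ?K (union_trans n) w (lvar (?o y1)))) = asem P Y G \<Gamma> w (pvar y1)"
      by (rule asem_eq_renamed_lrun[OF K valid(3,4) out(2) trans(2) w])
    have "frac_val (leval (union_out n) (lrun ?K (union_trans n) w (union_start n))) =
        evalp ?H (lsem (lrun ?K (union_trans n) w (union_start n)))" by (rule frac_val_leval) simp
    also have "\<dots> = evalp ?H (lsem (lrun ?K (union_trans n) w (lvar (?e x1))))
        - evalp ?H (lsem (lrun ?K (union_trans n) w (lvar (?o y1))))"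
      unfolding union_start_def n lsem_lrun_diff[OF K]
      using evalp_add[of ?H "lsem (lrun ?K (union_trans n) w (lvar (?e x1)))
        - lsem (lrun ?K (union_trans n) w (lvar (?o y1)))" "lsem (lrun ?K (union_trans n) w (lvar (?o y1)))"]
      by simp
    finally show ?thesis by (simp add: 1 2)
  qed
  have refutes: "refutes ?K n w \<longleftrightarrow> (\<forall>i\<in>set w. i < k) \<and> asem P X F \<Delta> w (pvar x1) \<noteq> asem P Y G \<Gamma> w (pvar y1)" for w
    unfolding refutes_def n frac_is_zero_iff using leval by auto
  then show "(\<exists>w. refutes ?K n w) \<longleftrightarrow>
      \<not> (\<forall>w. set w \<subseteq> {..<k} \<longrightarrow> asem P X F \<Delta> w (pvar x1) = asem P Y G \<Gamma> w (pvar y1))"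
    by auto
  \<comment> \<open>A finite set of variables closed under the transitions of the union, as
    completeness of certificates asks.\<close>
  define Z where "Z = ?e ` X \<union> ?o ` Y"
  have Zvars: "lvars (union_trans n i z) \<subseteq> Z" if "i < k" for i z
    using lvars_dec_trans[OF valid(1) that, of F "z div 2"] lvars_dec_trans[OF valid(3) that, of G "z div 2"]
    by (cases "odd z") (auto simp: union_trans_def n lvars_lrename Z_def)
  show "(\<exists>w. refutes ?K n w) \<longleftrightarrow> \<not> (\<exists>S. confirms ?K n S)"
  proof
    assume "\<exists>w. refutes ?K n w"
    moreover have "lsem (union_trans n i z) \<in> Q0" if "i < k" for i z
    proof -
      have "lsem (dec_trans ?a1 i x) \<in> Q0" "lsem (dec_trans ?a2 i x) \<in> Q0" for x
        using valid that fin by (auto simp: lsem_dec_trans valid_aut_def Q0_over_def Q0_closed)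
      then show ?thesis by (auto simp: union_trans_def n lsem_lrename_Q0)
    qed
    moreover have "lsem (union_start n) \<in> Q0"
      by (simp add: union_start_def Q0_closed)
    ultimately show "\<not> (\<exists>S. confirms ?K n S)"
      using certifies_imp_vanish[OF K, of k "union_trans n" "union_start n" "union_out n"]
      unfolding refutes_def confirms_def n by blast
  next
    assume no: "\<not> (\<exists>S. confirms ?K n S)"
    show "\<exists>w. refutes ?K n w"
    proof (rule ccontr)
      assume "\<not> ?thesis"
      then have "\<exists>W Q. certifies ?K k (union_trans n) (union_out n) (union_start n) W Q"
        unfolding refutes_def n using fin Zvars valid
        by (intro vanish_imp_certifies[OF K, of Z]) (auto simp: Z_def union_start_def n)
      then show False using no unfolding confirms_def n by auto
    qed
  qed
qed

end

theorem mainTheorem12: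
  fixes P :: "pv trm"
  assumes "BAC P"
  shows "\<exists>r. \<forall>k X F \<Delta> x1 Y G \<Gamma> y1.
           valid_aut k X \<Delta> \<and> x1 \<in> X \<and> valid_aut k Y \<Gamma> \<and> y1 \<in> Y \<longrightarrow>
           reval r [input_code k X F \<Delta> x1 Y G \<Gamma> y1]
             (if (\<forall>w. set w \<subseteq> {..<k} \<longrightarrow> asem P X F \<Delta> w (pvar x1) = asem P Y G \<Gamma> w (pvar y1))
              then 1 else 0)"
proof -
  obtain a b c where abc: "b * b = b + a * c"
    "\<And>\<sigma>. peval \<sigma> P = pconst a * (\<sigma> PX * \<sigma> PY) + pconst b * (\<sigma> PX * \<sigma> PYd + \<sigma> PXd * \<sigma> PY)
            + pconst c * (\<sigma> PXd * \<sigma> PYd)"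
    using BAC_normal_form[OF assms] by metis
  interpret bac_rule P a b c by standard (use abc in auto)
  obtain A B C where K: "frac_val A = a" "frac_val B = b" "frac_val C = c" using frac_val_surj by metis
  \<comment> \<open>The coefficients come from \<open>P\<close> alone, so \<open>r\<close> is chosen
    before alphabet and automata.\<close>
  obtain r where r: "\<And>n. ((\<exists>w. refutes (A, B, C) n w) \<longleftrightarrow> \<not> (\<exists>S. confirms (A, B, C) n S)) \<Longrightarrow>
     reval r [n] (if \<exists>w. refutes (A, B, C) n w then 0 else 1)"
    using ex_decision_procedure by blast
  show ?thesis
  proof (intro exI allI impI, elim conjE)
    fix k X F \<Delta> x1 Y G \<Gamma> y1
    assume valid: "valid_aut k X \<Delta>" "x1 \<in> X" "valid_aut k Y \<Gamma>" "y1 \<in> Y"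
    have eq: "(if (\<forall>w. set w \<subseteq> {..<k} \<longrightarrow> asem P X F \<Delta> w (pvar x1) = asem P Y G \<Gamma> w (pvar y1)) then 1 else 0)
      = (if \<exists>w. refutes (A, B, C) (input_code k X F \<Delta> x1 Y G \<Gamma> y1) w then 0 else 1 :: nat)"
      unfolding input_code_correct(1)[OF K valid] by simp
    show "reval r [input_code k X F \<Delta> x1 Y G \<Gamma> y1]
       (if (\<forall>w. set w \<subseteq> {..<k} \<longrightarrow> asem P X F \<Delta> w (pvar x1) = asem P Y G \<Gamma> w (pvar y1)) then 1 else 0)"
      unfolding eq by (rule r[OF input_code_correct(2)[OF K valid]])
  qed
qed

end
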